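(* The maximal stability intervals are given by the singletons $\{q\}$ where $q\in\overline{\mathcal U}$ and the intervals $(q_1,q_2]$ where $(q_1,q_2)$ is a connected component of $(1,\infty)\setminus\mathcal V$. Moreover, if $(q_1,q_2)$ is a connected component of $(1,\infty)\setminus\mathcal V$ with $q_1\in\mathcal V\setminus\mathcal U$, then $$\mathcal U_q'=\mathcal V_{q_1}'\quad\text{for all } q\in(q_1,q_2].$$
   Context: Let $\mathbb N=\{1,2,\dots\}$. A sequence is an element of $\{0,1,2,\dots\}^{\mathbb N}$; it is called infinite if it has infinitely many nonzero terms, and finite otherwise. Sequences are compared lexicographically. For a real $q>1$, let $\lceil q\rceil$ be the smallest integer $\ge q$ and let $J_q=[0,(\lceil q\rceil-1)/(q-1)]$. An expansion of a real number $x$ in base $q$ is a sequence $(c_i)$ of integers with $0\le c_i<q$ for all $i\ge1$ and $x=\sum_{i\ge1}c_iq^{-i}$. The quasi-greedy expansion $(a_i(x))$ of $x\in J_q\setminus\{0\}$ in base $q$ is its lexicographically largest infinite expansion (it exists); the quasi-greedy expansion of $0$ is $0^\infty$. Write $(\alpha_i)=(\alpha_i(q))$ for the quasi-greedy expansion of $1$ in base $q$; one has $\alpha_1=\lceil q\rceil-1$. For a digit $c\in\{0,\dots,\alpha_1\}$ put $\overline c=\alpha_1-c$, and $\overline{c_1c_2\ldots}=\overline{c_1}\,\overline{c_2}\ldots$. $\mathcal U$ is the set of real numbers $q>1$ for which $1$ has exactly one expansion in base $q$, and $\overline{\mathcal U}$ is its topological closure. $\mathcal V$ is the set of real numbers $q>1$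 for which $\overline{\alpha_{k+1}(q)\alpha_{k+2}(q)\ldots}\le\alpha_1(q)\alpha_2(q)\ldots$ for all $k\ge1$. One has $\mathcal U\subset\overline{\mathcal U}\subset\mathcal V$, and $\mathcal V$ is closed. For $q>1$, $\mathcal U_q$ is the set of real numbers $x$ having exactly one expansion in base $q$, and $$\mathcal V_q=\{x\in J_q:\ \overline{a_{n+1}(x)a_{n+2}(x)\ldots}\le\alpha_1\alpha_2\ldots\ \text{whenever } a_n(x)>0\}.$$ $\mathcal U_q'$ and $\mathcal V_q'$ are the sets of quasi-greedy expansions in base $q$ of all numbers $x\in\mathcal U_q$ and $x\in\mathcal V_q$, respectively. An interval $I\subset(1,\infty)$ (singletons allowed) is a stability interval if $\mathcal U_q'=\mathcal U_s'$ for all $q,s\in I$; maximality is with respect to inclusion. *)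

theory Defs
  imports "HOL-Analysis.Analysis" "HOL-Library.Fun_Lexorder"
begin

text \<open>
  Sequences $(c_1, c_2, \ldots)$ of nonnegative integers are functions \<open>c :: nat \<Rightarrow> nat\<close>
  indexed from 0: the term $c_{i+1}$ is \<open>c i\<close>, so the tail $c_{k+1} c_{k+2} \ldots$ is
  \<open>\<lambda>i. c (k + i)\<close>.
\<close>

definition lex_le :: "(nat \<Rightarrow> nat) \<Rightarrow> (nat \<Rightarrow> nat) \<Rightarrow> bool" where
  "lex_le c d \<longleftrightarrow> less_fun c d \<or> c = d"

definition infinite_seq :: "(nat \<Rightarrow> nat) \<Rightarrow> bool" where
  "infinite_seq c \<longleftrightarrow> infinite {i. c i \<noteq> 0}"

definition expansion :: "real \<Rightarrow> real \<Rightarrow> (nat \<Rightarrow> nat) \<Rightarrow> bool" where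
  "expansion q x c \<longleftrightarrow>
     (\<forall>i. real (c i) < q) \<and> (\<lambda>i. real (c i) / q ^ Suc i) sums x"

definition J :: "real \<Rightarrow> real set" where
  "J q = {0 .. (real_of_int \<lceil>q\<rceil> - 1) / (q - 1)}"

text \<open>Only meaningful for \<open>q > 1\<close> and \<open>x \<in> J q\<close>; the sequence described exists there.\<close>

definition quasi_greedy :: "real \<Rightarrow> real \<Rightarrow> (nat \<Rightarrow> nat)" where
  "quasi_greedy q x =
     (if x = 0 then (\<lambda>_. 0)
      else (THE c. expansion q x c \<and> infinite_seq c \<and>
                   (\<forall>d. expansion q x d \<and> infinite_seq d \<longrightarrow> lex_le d c)))"

definition alpha :: "real \<Rightarrow> (nat \<Rightarrow> nat)" where
  "alpha q = quasi_greedy q 1"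

text \<open>
  The natural number subtraction is only applied to digits \<open>c i < q\<close>, for which
  \<open>c i \<le> \<lceil>q\<rceil> - 1 = alpha q 0\<close>, so it never truncates there.
\<close>

definition reflection :: "real \<Rightarrow> (nat \<Rightarrow> nat) \<Rightarrow> (nat \<Rightarrow> nat)" where
  "reflection q c = (\<lambda>i. alpha q 0 - c i)"

definition U :: "real set" where
  "U = {q. q > 1 \<and> (\<exists>!c. expansion q 1 c)}"

definition V :: "real set" where
  "V = {q. q > 1 \<and> (\<forall>k\<ge>1. lex_le (reflection q (\<lambda>i. alpha q (k + i))) (alpha q))}"

definition U_base :: "real \<Rightarrow> real set" where
  "U_base q = {x. \<exists>!c. expansion q x c}"

text \<open>With $n$ counted from 1, $a_n(x)$ is the entry at index \<open>n - 1\<close>.\<close>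

definition V_base :: "real \<Rightarrow> real set" where
  "V_base q = {x \<in> J q. \<forall>n\<ge>1. quasi_greedy q x (n - 1) > 0 \<longrightarrow>
      lex_le (reflection q (\<lambda>i. quasi_greedy q x (n + i))) (alpha q)}"

definition U_seqs :: "real \<Rightarrow> (nat \<Rightarrow> nat) set" where
  "U_seqs q = quasi_greedy q ` U_base q"

definition V_seqs :: "real \<Rightarrow> (nat \<Rightarrow> nat) set" where
  "V_seqs q = quasi_greedy q ` V_base q"

definition stability_interval :: "real set \<Rightarrow> bool" where
  "stability_interval I \<longleftrightarrow>
     I \<noteq> {} \<and> is_interval I \<and> I \<subseteq> {1<..} \<and> (\<forall>q\<in>I. \<forall>s\<in>I. U_seqs q = U_seqs s)"

definition maximal_stability_interval :: "real set \<Rightarrow> bool" where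
  "maximal_stability_interval I \<longleftrightarrow>
     stability_interval I \<and> (\<forall>I'. stability_interval I' \<and> I \<subseteq> I' \<longrightarrow> I' = I)"

end

theory Submission
  imports Defs
begin

text \<open>
  Everything is reduced to the lexicographic order on digit sequences. By Parry's theorem the map
  \<open>q \<mapsto> alpha q\<close> is a strictly increasing bijection from the bases \<open>q > 1\<close> onto the infinite
  sequences that dominate all their tails (\<open>alpha_strict_mono\<close>, \<open>shift_alpha_le\<close>, \<open>alpha_surj\<close>). The
  membership of a sequence in \<open>U_seqs q\<close> or \<open>V_seqs q\<close>, and of \<open>q\<close> itself in \<open>U\<close> or \<open>V\<close>, is decided by
  comparing certain tails, and complements of tails, with \<open>alpha q\<close> (\<open>U_seqs_iff\<close>, \<open>V_seqs_iff\<close>,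
  \<open>U_iff\<close>, \<open>V_iff\<close>). In particular \<open>U_seqs q\<close> grows with \<open>q\<close> as long as the alphabet does not change.

  For a fixed top digit \<open>A\<close>, the sequences \<open>alpha p\<close> with \<open>p \<in> V\<close> form the set \<open>self_bounded A\<close>,
  which is closed under lexicographic suprema and infima. Hence every base \<open>q > 1\<close> outside \<open>V\<close> lies
  in a gap whose right endpoint is in \<open>V\<close> and whose left endpoint is in \<open>V\<close> or equal to 1
  (\<open>ex_V_gap\<close>), and these gaps are the components of the complement of \<open>V\<close>.

  Stability breaks at the points of \<open>V\<close>: if \<open>p \<in> V\<close> and \<open>q \<le> p < s\<close>, then the sequence
  consisting of a digit 0 followed by \<open>alpha p\<close> is in \<open>U_seqs s\<close> but not in \<open>U_seqs q\<close>, unless already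
  the alphabets differ (\<open>U_seqs_separated\<close>). So a stability interval with more than one point is
  contained in \<open>{q1<..q2}\<close> for some gap from \<open>q1\<close> to \<open>q2\<close>.

  Conversely \<open>U_seqs\<close> is constant on \<open>{q1<..q2}\<close> (\<open>U_seqs_const_on_gap\<close>). The supremum of the
  relevant tails of a sequence in \<open>U_seqs q2\<close> is, when it is at least \<open>alpha q\<close> for some \<open>q\<close> in the
  gap, itself of the form \<open>alpha r\<close> with \<open>r \<in> V\<close> (\<open>sup_tails_alpha\<close>), so \<open>r = q2\<close>. This is
  excluded because \<open>q2\<close> is isolated in \<open>V\<close> from the left. The same supremum gives the description of
  \<open>U_seqs\<close> along the gap by \<open>V_seqs q1\<close>.

  It remains to see which points of \<open>V\<close> are right endpoints of gaps. A base \<open>q \<in> V\<close> is isolated in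
  \<open>V\<close> from the left if and only if some proper tail of \<open>alpha q\<close> has complement exactly \<open>alpha q\<close>
  (\<open>V_left_isolated\<close>, \<open>V_left_limit\<close>), and these are exactly the points of \<open>V\<close> outside the closure
  of \<open>U\<close> (\<open>closure_U_iff\<close>). The approximations needed here are obtained by cutting \<open>alpha q\<close> after a
  good prefix, and arbitrarily long good prefixes exist (\<open>ex_good_prefix\<close>).
\<close>

section \<open>Lexicographic order on digit sequences\<close>

notation less_fun (infix "\<sqsubset>" 50)
notation lex_le (infix "\<sqsubseteq>" 50)

lemma lex_trichotomy:
  fixes c d :: "nat \<Rightarrow> nat"
  shows "c \<sqsubset> d \<or> c = d \<or> d \<sqsubset> c"
proof (cases "c = d")
  case False
  then obtain k where "c k \<noteq> d k" by blast
  define m where "m = (LEAST k. c k \<noteq> d k)"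
  have m: "c m \<noteq> d m" "\<forall>j<m. c j = d j"
    using \<open>c k \<noteq> d k\<close> LeastI[of "\<lambda>k. c k \<noteq> d k"] not_less_Least[of _ "\<lambda>k. c k \<noteq> d k"]
    unfolding m_def by blast+
  then have "c m < d m \<or> d m < c m" by linarith
  then show ?thesis unfolding less_fun_def using m by metis
qed simp

interpretation lex: linorder lex_le less_fun
proof
  fix c d e :: "nat \<Rightarrow> nat"
  show "c \<sqsubset> d \<longleftrightarrow> c \<sqsubseteq> d \<and> \<not> d \<sqsubseteq> c"
    unfolding lex_le_def using less_fun_asym less_fun_irrefl by blast
  show "c \<sqsubseteq> c" unfolding lex_le_def by simp
  show "c \<sqsubseteq> d \<Longrightarrow> d \<sqsubseteq> e \<Longrightarrow> c \<sqsubseteq> e"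
    unfolding lex_le_def using less_fun_trans by blast
  show "c \<sqsubseteq> d \<Longrightarrow> d \<sqsubseteq> c \<Longrightarrow> c = d"
    unfolding lex_le_def using less_fun_asym by blast
  show "c \<sqsubseteq> d \<or> d \<sqsubseteq> c" unfolding lex_le_def using lex_trichotomy by blast
qed

text \<open>
  The tail of a sequence obtained by deleting its first \<open>n\<close> terms.
\<close>

definition shift :: "nat \<Rightarrow> (nat \<Rightarrow> nat) \<Rightarrow> nat \<Rightarrow> nat" where
  "shift n c = (\<lambda>i. c (n + i))"

lemma shift_apply [simp]: "shift n c i = c (n + i)"
  by (simp add: shift_def)

lemma shift_0 [simp]: "shift 0 c = c"
  by (simp add: shift_def)

lemma shift_shift [simp]: "shift m (shift n c) = shift (n + m) c"
  by (simp add: shift_def add.assoc)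

definition digits_le :: "nat \<Rightarrow> (nat \<Rightarrow> nat) \<Rightarrow> bool" where
  "digits_le A c \<longleftrightarrow> (\<forall>i. c i \<le> A)"

lemma digits_leD: "digits_le A c \<Longrightarrow> c i \<le> A"
  by (simp add: digits_le_def)

lemma digits_le_shift [simp]: "digits_le A c \<Longrightarrow> digits_le A (shift n c)"
  by (simp add: digits_le_def)

text \<open>
  The digitwise complement with respect to the top digit \<open>A\<close>. The subtraction does not truncate on
  sequences with \<open>digits_le A\<close>, and complementation reverses their order.
\<close>

definition compl_seq :: "nat \<Rightarrow> (nat \<Rightarrow> nat) \<Rightarrow> nat \<Rightarrow> nat" where
  "compl_seq A c = (\<lambda>i. A - c i)"

lemma compl_seq_apply [simp]: "compl_seq A c i = A - c i"
  by (simp add: compl_seq_def)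

lemma digits_le_compl [simp]: "digits_le A (compl_seq A c)"
  by (simp add: digits_le_def)

lemma shift_compl: "shift n (compl_seq A c) = compl_seq A (shift n c)"
  by (simp add: shift_def compl_seq_def)

lemma compl_compl [simp]: "digits_le A c \<Longrightarrow> compl_seq A (compl_seq A c) = c"
  by (rule ext) (simp add: digits_le_def)

lemma compl_less_iff:
  assumes "digits_le A c" "digits_le A d"
  shows "compl_seq A c \<sqsubset> compl_seq A d \<longleftrightarrow> d \<sqsubset> c"
proof -
  have "\<And>i. A - c i = A - d i \<longleftrightarrow> c i = d i" "\<And>i. A - c i < A - d i \<longleftrightarrow> d i < c i"
    using assms unfolding digits_le_def
      by (metis diff_diff_cancel, metis diff_le_mono2 diff_less_mono2 leD leI le_less_trans)
  then show ?thesis unfolding less_fun_def by (auto simp: eq_commute)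
qed

lemma compl_le_iff:
  assumes "digits_le A c" "digits_le A d"
  shows "compl_seq A c \<sqsubseteq> compl_seq A d \<longleftrightarrow> d \<sqsubseteq> c"
  using compl_less_iff[OF assms(2,1)] by (simp add: lex.not_less[symmetric])

lemma shift_less_iff:
  assumes "\<And>i. i < k \<Longrightarrow> c i = d i"
  shows "shift k c \<sqsubset> shift k d \<longleftrightarrow> c \<sqsubset> d"
proof
  assume "shift k c \<sqsubset> shift k d"
  then obtain j where j: "c (k + j) < d (k + j)" "\<And>i. i < j \<Longrightarrow> c (k + i) = d (k + i)"
    by (auto elim!: less_funE)
  have "c i = d i" if "i < k + j" for i
    using assms[of i] j(2)[of "i - k"] that by (cases "i < k") auto
  then show "c \<sqsubset> d" unfolding less_fun_def using j(1) by blast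
next
  assume "c \<sqsubset> d"
  then obtain j where j: "c j < d j" "\<And>i. i < j \<Longrightarrow> c i = d i"
    by (auto elim!: less_funE)
  then have "k \<le> j" using assms by (metis less_irrefl not_le)
  then show "shift k c \<sqsubset> shift k d" unfolding less_fun_def
    using j by (intro exI[of _ "j - k"]) auto
qed

lemma shift_le_iff:
  assumes "\<And>i. i < k \<Longrightarrow> c i = d i"
  shows "shift k c \<sqsubseteq> shift k d \<longleftrightarrow> c \<sqsubseteq> d"
  using shift_less_iff[of k d c] assms by (simp add: lex.not_less[symmetric])

text \<open>
  Prepending a top digit never decreases a sequence.
\<close>

lemma shift_Suc_le_shift:
  assumes "digits_le A c" "c k = A"
  shows "shift (Suc k) c \<sqsubseteq> shift k c"
proof (rule ccontr)
  assume "\<not> ?thesis"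
  then have "shift k c \<sqsubset> shift (Suc k) c" by (simp add: lex.not_le)
  then obtain j where j: "c (k + j) < c (Suc k + j)" "\<And>i. i < j \<Longrightarrow> c (k + i) = c (Suc k + i)"
    by (auto elim!: less_funE)
  have "c (k + i) = A" if "i \<le> j" for i
    using that by (induction i) (use assms j in \<open>auto simp: Suc_le_eq\<close>)
  then show False using j(1) digits_leD[OF assms(1), of "Suc k + j"] by simp
qed

text \<open>
  Conditions on tails will only be given for tails that follow a digit below the top one. Once such a
  digit has occurred, every later tail is bounded by one of these: go back to the last digit below \<open>A\<close>.
  Applied to complements, the same holds for tails that follow a positive digit.
\<close>

lemma shift_le_shift_after_small:
  assumes c: "digits_le A c" and m: "c m < A" and "m < k"
  shows "\<exists>n\<ge>m. n < k \<and> c n < A \<and> shift k c \<sqsubseteq> shift (Suc n) c"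
  using \<open>m < k\<close>
proof (induction k)
  case (Suc k)
  show ?case
  proof (cases "c k < A")
    case True
    then show ?thesis using Suc.prems by (intro exI[of _ k]) (simp add: less_Suc_eq_le)
  next
    case False
    then have "c k = A" using digits_leD[OF c, of k] by simp
    have "m < k" using Suc.prems \<open>c k = A\<close> m by (metis less_antisym less_irrefl)
    then obtain n where "n \<ge> m" "n < k" "c n < A" "shift k c \<sqsubseteq> shift (Suc n) c"
      using Suc.IH by blast
    then show ?thesis using shift_Suc_le_shift[OF c \<open>c k = A\<close>] lex.order_trans less_SucI
      by blast
  qed
qed simp

text \<open>
  Sequences over a finite alphabet have lexicographic suprema, and the supremum can be approximated to
  any length. Its digits are chosen one by one, each as large as possible.
\<close>

lemma lex_sup:
  assumes "S \<noteq> {}" and dig: "\<And>s. s \<in> S \<Longrightarrow> digits_le A s"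
  obtains t where "\<And>s. s \<in> S \<Longrightarrow> s \<sqsubseteq> t" "\<And>m. \<exists>s\<in>S. \<forall>i<m. s i = t i" "digits_le A t"
proof -
  \<comment> \<open>\<open>P m x\<close>: among the elements of \<open>S\<close>, the first \<open>m\<close> digits of \<open>x\<close> are maximal\<close>
  define P where "P m x \<longleftrightarrow> x \<in> S \<and> (\<forall>s\<in>S. (\<forall>i<m. s i = x i) \<or> s \<sqsubset> x)" for m x
  have step: "\<exists>y. P (Suc m) y \<and> (\<forall>i<m. y i = x i)" if "P m x" for m x
  proof -
    let ?D = "{s m | s. s \<in> S \<and> (\<forall>i<m. s i = x i)}"
    have "finite ?D" by (rule finite_subset[of _ "{..A}"]) (use dig digits_leD in auto)
    moreover have "?D \<noteq> {}" using that unfolding P_def by blast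
    ultimately have "Max ?D \<in> ?D" and mx: "\<And>d. d \<in> ?D \<Longrightarrow> d \<le> Max ?D"
      using Max_in[of ?D] Max_ge[of ?D] by blast+
    then obtain y where y: "y \<in> S" "\<forall>i<m. y i = x i" "Max ?D = y m" by auto
    have "(\<forall>i<Suc m. s i = y i) \<or> s \<sqsubset> y" if s: "s \<in> S" for s
    proof (cases "\<forall>i<m. s i = x i")
      case True
      then have "s m \<le> y m" using mx[of "s m"] s y(3) by auto
      then consider "s m < y m" | "s m = y m" by linarith
      then show ?thesis
      proof cases
        case 1
        then have "s \<sqsubset> y" unfolding less_fun_def using True y(2) by (intro exI[of _ m]) auto
        then show ?thesis ..
      qed (use True y(2) in \<open>auto simp: less_Suc_eq\<close>)
    next
      case False
      then have "s \<sqsubset> x" using \<open>P m x\<close> s unfolding P_def by blast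
      then obtain k where k: "s k < x k" "\<And>i. i < k \<Longrightarrow> s i = x i"
        by (auto elim!: less_funE)
      then have "k < m" using False by (meson le_less_trans not_le order.strict_trans1)
      then have "s \<sqsubset> y" unfolding less_fun_def using k y(2) by (intro exI[of _ k]) auto
      then show ?thesis ..
    qed
    then show ?thesis using y unfolding P_def by blast
  qed
  obtain x0 where "P 0 x0" using assms(1) unfolding P_def by auto
  then obtain f where f: "\<And>m. P m (f m)" "\<And>m. \<forall>i<m. f (Suc m) i = f m i"
    using dependent_nat_choice[of P "\<lambda>m x y. \<forall>i<m. y i = x i"] step by metis
  define t where "t i = f (Suc i) i" for i
  have ft: "f m i = t i" if "i < m" for m i
    using that
  proof (induction m)
    case (Suc m)
    then show ?case using f(2)[of m] unfolding t_def by (cases "i = m") auto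
  qed simp
  show thesis
  proof (rule that[of t])
    show "\<exists>s\<in>S. \<forall>i<m. s i = t i" for m
      using f(1)[of m] ft[of _ m] unfolding P_def by blast
    show "digits_le A t" unfolding digits_le_def t_def
      using f(1) dig digits_leD unfolding P_def by blast
    show "s \<sqsubseteq> t" if s: "s \<in> S" for s
    proof (rule ccontr)
      assume "\<not> s \<sqsubseteq> t"
      then obtain k where k: "t k < s k" "\<And>i. i < k \<Longrightarrow> t i = s i"
        by (auto simp: lex.not_le elim!: less_funE)
      have "f (Suc k) \<sqsubset> s" unfolding less_fun_def
        using k ft[of _ "Suc k"] by (intro exI[of _ k]) auto
      moreover have "\<not> (\<forall>i<Suc k. s i = f (Suc k) i)" using k(1) ft[of k "Suc k"] by auto
      ultimately show False using f(1)[of "Suc k"] s unfolding P_def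
        using less_fun_asym by blast
    qed
  qed
qed

lemma lex_inf:
  assumes "S \<noteq> {}" and dig: "\<And>s. s \<in> S \<Longrightarrow> digits_le A s"
  obtains t where "\<And>s. s \<in> S \<Longrightarrow> t \<sqsubseteq> s" "\<And>m. \<exists>s\<in>S. \<forall>i<m. s i = t i" "digits_le A t"
proof -
  obtain t where t: "\<And>s. s \<in> compl_seq A ` S \<Longrightarrow> s \<sqsubseteq> t"
    "\<And>m. \<exists>s\<in>compl_seq A ` S. \<forall>i<m. s i = t i" "digits_le A t"
  proof (rule lex_sup[of "compl_seq A ` S" A])
    show "compl_seq A ` S \<noteq> {}" using assms(1) by simp
    show "digits_le A s" if "s \<in> compl_seq A ` S" for s using that by auto
  qed blast
  show thesis
  proof (rule that[of "compl_seq A t"])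
    show "compl_seq A t \<sqsubseteq> s" if "s \<in> S" for s
      using t(1)[of "compl_seq A s"] that compl_le_iff[OF t(3) digits_le_compl[of A s]]
        dig[OF that] by simp
    show "\<exists>s\<in>S. \<forall>i<m. s i = compl_seq A t i" for m
    proof -
      obtain s where "s \<in> S" "\<forall>i<m. compl_seq A s i = t i" using t(2)[of m] by auto
      then show ?thesis using digits_leD[OF dig] 
        by (intro bexI[of _ s]) (metis compl_seq_apply diff_diff_cancel, simp)
    qed
  qed simp
qed

text \<open>
  The order relation is closed for digitwise convergence.
\<close>

lemma lex_le_limit:
  assumes "\<And>m. \<exists>c' d'. (\<forall>i<m. c' i = c i) \<and> (\<forall>i<m. d' i = d i) \<and> c' \<sqsubseteq> d'"
  shows "c \<sqsubseteq> d"
proof (rule ccontr)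
  assume "\<not> c \<sqsubseteq> d"
  then obtain k where k: "d k < c k" "\<And>i. i < k \<Longrightarrow> d i = c i"
    by (auto simp: lex.not_le elim!: less_funE)
  obtain c' d' where *: "\<forall>i<Suc k. c' i = c i" "\<forall>i<Suc k. d' i = d i" "c' \<sqsubseteq> d'"
    using assms by blast
  then have "d' \<sqsubset> c'" unfolding less_fun_def using k by (intro exI[of _ k]) auto
  then show False using *(3) by (simp add: lex.not_le[symmetric])
qed

section \<open>Values of digit sequences\<close>

text \<open>
  The number represented by a sequence in base \<open>q\<close>.
\<close>

definition val :: "real \<Rightarrow> (nat \<Rightarrow> nat) \<Rightarrow> real" where
  "val q c = (\<Sum>i. real (c i) / q ^ Suc i)"

lemma geometric_tail_sums:
  fixes q :: real
  assumes "q > 1"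
  shows "(\<lambda>i. a / q ^ Suc i) sums (a / (q - 1))"
proof -
  have "(\<lambda>i. (a / q) * (1 / q) ^ i) sums ((a / q) * (1 / (1 - 1 / q)))"
    by (intro sums_mult geometric_sums) (use assms in simp)
  moreover have "(a / q) * (1 / (1 - 1 / q)) = a / (q - 1)" using assms by (simp add: field_simps)
  moreover have "(\<lambda>i. (a / q) * (1 / q) ^ i) = (\<lambda>i. a / q ^ Suc i)"
    by (simp add: power_one_over)
  ultimately show ?thesis by metis
qed

lemma infinite_seq_shift [simp]: "infinite_seq (shift n c) \<longleftrightarrow> infinite_seq c"
proof
  assume *: "infinite_seq c"
  show "infinite_seq (shift n c)" unfolding infinite_seq_def infinite_nat_iff_unbounded
  proof
    fix m
    obtain k where "k > n + m" "c k \<noteq> 0"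
      using * unfolding infinite_seq_def infinite_nat_iff_unbounded by blast
    then show "\<exists>k>m. k \<in> {i. shift n c i \<noteq> 0}" by (intro exI[of _ "k - n"]) auto
  qed
next
  assume *: "infinite_seq (shift n c)"
  show "infinite_seq c" unfolding infinite_seq_def infinite_nat_iff_unbounded
  proof
    fix m
    obtain k where "k > m" "c (n + k) \<noteq> 0"
      using * unfolding infinite_seq_def infinite_nat_iff_unbounded by auto
    then show "\<exists>k>m. k \<in> {i. c i \<noteq> 0}" by (intro exI[of _ "n + k"]) auto
  qed
qed

lemma infinite_seqD: "infinite_seq c \<Longrightarrow> \<exists>i\<ge>n. c i \<noteq> 0"
  unfolding infinite_seq_def infinite_nat_iff_unbounded_le by auto

lemma infinite_seqI: "(\<And>n. \<exists>i\<ge>n. c i \<noteq> 0) \<Longrightarrow> infinite_seq c"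
  unfolding infinite_seq_def infinite_nat_iff_unbounded_le by auto

context
  fixes q :: real
  assumes q: "q > 1"
begin

lemma val_sums:
  assumes "digits_le A c"
  shows "(\<lambda>i. real (c i) / q ^ Suc i) sums val q c"
proof -
  have "summable (\<lambda>i. real (c i) / q ^ Suc i)"
  proof (rule summable_comparison_test')
    show "summable (\<lambda>i. real A / q ^ Suc i)" using geometric_tail_sums[OF q] sums_summable
      by blast
    show "norm (real (c n) / q ^ Suc n) \<le> real A / q ^ Suc n" for n
      using q digits_leD[OF assms, of n] by (simp add: divide_right_mono)
  qed
  then show ?thesis unfolding val_def by (rule summable_sums)
qed

lemma val_nonneg: "digits_le A c \<Longrightarrow> 0 \<le> val q c"
  by (rule sums_le[OF _ sums_zero val_sums]) (use q in auto)

lemma val_le: "digits_le A c \<Longrightarrow> val q c \<le> A / (q - 1)"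
  by (rule sums_le[OF _ val_sums geometric_tail_sums[OF q]])
    (use q in \<open>auto intro!: divide_right_mono simp: digits_leD\<close>)

lemma val_compl:
  assumes "digits_le A c"
  shows "val q (compl_seq A c) = A / (q - 1) - val q c"
proof -
  have "(\<lambda>i. real A / q ^ Suc i - real (c i) / q ^ Suc i) sums (A / (q - 1) - val q c)"
    by (intro sums_diff val_sums[OF assms] geometric_tail_sums[OF q])
  moreover have "real A / q ^ Suc i - real (c i) / q ^ Suc i = real (compl_seq A c i) / q ^ Suc i" for i
    using digits_leD[OF assms, of i] by (simp add: diff_divide_distrib[symmetric])
  ultimately have "(\<lambda>i. real (compl_seq A c i) / q ^ Suc i) sums (A / (q - 1) - val q c)" by simp
  then show ?thesis using val_sums[OF digits_le_compl] sums_unique2 by blast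
qed

lemma val_split:
  assumes "digits_le A c"
  shows "val q c = (\<Sum>i<k. real (c i) / q ^ Suc i) + val q (shift k c) / q ^ k"
proof -
  have "(\<lambda>i. real (c (i + k)) / q ^ Suc (i + k)) sums (val q c - (\<Sum>i<k. real (c i) / q ^ Suc i))"
    using sums_split_initial_segment[OF val_sums[OF assms], of k] by simp
  moreover have "(\<lambda>i. real (shift k c i) / q ^ Suc i / q ^ k) sums (val q (shift k c) / q ^ k)"
    by (intro sums_divide val_sums[of A] digits_le_shift assms)
  moreover have "(\<lambda>i. real (shift k c i) / q ^ Suc i / q ^ k) = (\<lambda>i. real (c (i + k)) / q ^ Suc (i + k))"
    by (simp add: power_add add.commute mult.assoc)
  ultimately have "val q c - (\<Sum>i<k. real (c i) / q ^ Suc i) = val q (shift k c) / q ^ k"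
    using sums_unique2 by metis
  then show ?thesis by linarith
qed

lemma val_diff:
  assumes "digits_le A c" "digits_le B d" "\<forall>i<k. c i = d i"
  shows "val q d - val q c =
    (real (d k) - real (c k) + val q (shift (Suc k) d) - val q (shift (Suc k) c)) / q ^ Suc k"
proof -
  have "(\<Sum>i<k. real (c i) / q ^ Suc i) = (\<Sum>i<k. real (d i) / q ^ Suc i)"
    using assms(3) by simp
  then show ?thesis
    by (subst val_split[OF assms(1), of "Suc k"], subst val_split[OF assms(2), of "Suc k"])
      (simp add: add_divide_distrib diff_divide_distrib)
qed

lemma val_zero_iff:
  assumes "digits_le A c"
  shows "val q c = 0 \<longleftrightarrow> c = (\<lambda>_. 0)"
proof
  assume "val q c = 0"
  then have "(\<Sum>i. real (c i) / q ^ Suc i) = 0" unfolding val_def .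
  then have "\<forall>i. real (c i) / q ^ Suc i = 0"
    using suminf_eq_zero_iff[of "\<lambda>i. real (c i) / q ^ Suc i"] sums_summable[OF val_sums[OF assms]] q
      by simp
  then show "c = (\<lambda>_. 0)" using q by auto
qed (simp add: val_def)

lemma val_pos:
  assumes "digits_le A c" "infinite_seq c"
  shows "0 < val q c"
proof -
  have "c \<noteq> (\<lambda>_. 0)" using infinite_seqD[OF assms(2)] by auto
  then show ?thesis using val_nonneg[OF assms(1)] val_zero_iff[OF assms(1)] by simp
qed

text \<open>
  The largest digit in base \<open>q\<close>, equal to \<open>alpha q 0\<close> by the lemma \<open>alpha_0\<close> below.
\<close>

definition top_digit :: nat where "top_digit = nat \<lceil>q\<rceil> - 1"

lemma top_digit: "1 \<le> top_digit" "real top_digit < q" "q \<le> real top_digit + 1"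
  using q unfolding top_digit_def by linarith+

lemma real_of_top_digit: "real top_digit = real_of_int \<lceil>q\<rceil> - 1"
  using q unfolding top_digit_def by linarith

lemma less_base_iff: "real d < q \<longleftrightarrow> d \<le> top_digit"
  using q unfolding top_digit_def by linarith

lemma expansion_iff: "expansion q x c \<longleftrightarrow> digits_le top_digit c \<and> val q c = x"
  using val_sums[of top_digit c] sums_unique2
  unfolding expansion_def less_base_iff digits_le_def[symmetric] by blast

lemma top_digit_sum_ge: "1 \<le> top_digit / (q - 1)"
  using q top_digit by (simp add: field_simps)

section \<open>Quasi-greedy expansions\<close>

text \<open>
  The quasi-greedy algorithm: from a remainder \<open>y > 0\<close>, take the largest digit that is strictly
  smaller than \<open>q * y\<close>. Remainders stay positive, so the expansion is infinite, and the remainder after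
  a digit below the top one is at most 1.
\<close>

lemma exists_quasi_greedy:
  assumes "0 < x" "x \<le> top_digit / (q - 1)"
  shows "\<exists>c. digits_le top_digit c \<and> infinite_seq c \<and> val q c = x \<and>
    (\<forall>n. c n < top_digit \<longrightarrow> val q (shift (Suc n) c) \<le> 1)"
proof -
  define dig where "dig y = min top_digit (nat \<lceil>q * y\<rceil> - 1)" for y
  define next_rem where "next_rem y = q * y - real (dig y)" for y
  define R where "R = {0 <.. top_digit / (q - 1)}"
  have next_R: "next_rem y \<in> R" "dig y < top_digit \<Longrightarrow> next_rem y \<le> 1" if "y \<in> R" for y
  proof -
    have y: "0 < q * y" "y \<le> top_digit / (q - 1)" using that q unfolding R_def by auto
    have "real (dig y) < q * y" unfolding dig_def using y(1) by linarith
    moreover show *: "next_rem y \<le> 1" if "dig y < top_digit"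
      using that y(1) unfolding next_rem_def dig_def by linarith
    moreover have "next_rem y \<le> top_digit / (q - 1)" if "\<not> dig y < top_digit"
    proof -
      have "next_rem y = q * y - top_digit" using that unfolding next_rem_def dig_def by simp
      also have "\<dots> \<le> q * (top_digit / (q - 1)) - top_digit"
        using y(2) q mult_left_mono[of y "top_digit / (q - 1)" q] by simp
      also have "\<dots> = top_digit / (q - 1)" using q by (simp add: field_simps)
      finally show ?thesis .
    qed
    ultimately show "next_rem y \<in> R" unfolding R_def using top_digit_sum_ge
      by (auto simp: next_rem_def) (metis next_rem_def order_trans)
  qed
  define rem where "rem n = (next_rem ^^ n) x" for n
  define c where "c n = dig (rem n)" for n
  have rem_R: "rem n \<in> R" for n
    by (induction n) (use assms next_R(1) in \<open>auto simp: rem_def R_def\<close>)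
  have dig_c: "digits_le top_digit c" unfolding digits_le_def c_def dig_def by simp
  have rem_eq: "q * rem n - real (c n) = rem (Suc n)" for n
    unfolding c_def rem_def next_rem_def by simp
  have part: "rem n = (\<Sum>i<k. real (c (n + i)) / q ^ Suc i) + rem (n + k) / q ^ k" for n k
  proof (induction k)
    case (Suc k)
    have "rem (n + k) = (real (c (n + k)) + rem (n + Suc k)) / q"
      using rem_eq[of "n + k"] q by (simp add: field_simps)
    with Suc show ?case using q by (simp add: field_simps)
  qed simp
  have val_rem: "val q (shift n c) = rem n" for n
  proof -
    have "(\<lambda>k. rem (n + k) / q ^ k) \<longlonglongrightarrow> 0"
    proof (rule tendsto_sandwich[of "\<lambda>_. 0" _ _ "\<lambda>k. (top_digit / (q - 1)) * (1 / q) ^ k"])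
      show "(\<lambda>k. (top_digit / (q - 1)) * (1 / q) ^ k) \<longlonglongrightarrow> 0"
        using q by (intro tendsto_mult_right_zero LIMSEQ_power_zero) simp
      show "\<forall>\<^sub>F k in sequentially. rem (n + k) / q ^ k \<le> (top_digit / (q - 1)) * (1 / q) ^ k"
        using rem_R q unfolding R_def by (auto simp: power_one_over divide_simps)
      show "\<forall>\<^sub>F k in sequentially. 0 \<le> rem (n + k) / q ^ k"
        using rem_R q unfolding R_def by (auto intro!: always_eventually less_imp_le)
    qed simp
    then have "(\<lambda>k. rem n - rem (n + k) / q ^ k) \<longlonglongrightarrow> rem n - 0"
      by (intro tendsto_intros)
    moreover have "rem n - rem (n + k) / q ^ k = (\<Sum>i<k. real (shift n c i) / q ^ Suc i)" for k
      using part[of n k] by simp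
    ultimately have "(\<lambda>i. real (shift n c i) / q ^ Suc i) sums rem n" unfolding sums_def by simp
    then show ?thesis using val_sums[OF digits_le_shift[OF dig_c]] sums_unique2 by blast
  qed
  have "infinite_seq c"
  proof (rule infinite_seqI)
    fix n
    have "val q (shift n c) \<noteq> 0" using val_rem rem_R[of n] unfolding R_def by simp
    then have "shift n c \<noteq> (\<lambda>_. 0)" using val_zero_iff[OF digits_le_shift[OF dig_c]]
      by blast
    then obtain i where "shift n c i \<noteq> 0" by blast
    then show "\<exists>i\<ge>n. c i \<noteq> 0" by (intro exI[of _ "n + i"]) simp
  qed
  moreover have "val q (shift (Suc n) c) \<le> 1" if "c n < top_digit" for n
    using next_R(2)[OF rem_R[of n]] that val_rem[of "Suc n"] by (simp add: c_def rem_def)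
  ultimately show ?thesis using dig_c val_rem[of 0] by (intro exI[of _ c]) (simp add: rem_def)
qed

lemma quasi_greedy_eqI:
  assumes c: "digits_le top_digit c" "infinite_seq c" "val q c = x"
    and small: "\<And>n. c n < top_digit \<Longrightarrow> val q (shift (Suc n) c) \<le> 1"
  shows "quasi_greedy q x = c"
proof -
  have "x \<noteq> 0" using val_pos[OF c(1,2)] c(3) by simp
  have "d \<sqsubseteq> c" if d: "expansion q x d" "infinite_seq d" for d
  proof (rule ccontr)
    assume "\<not> d \<sqsubseteq> c"
    then obtain k where k: "c k < d k" "\<forall>i<k. c i = d i"
      by (auto simp: lex.not_le elim!: less_funE)
    have dd: "digits_le top_digit d" "val q d = x" using d(1) expansion_iff by auto
    have "val q (shift (Suc k) c) \<le> 1" using small k(1) digits_leD[OF dd(1), of k] by simp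
    moreover have "0 < val q (shift (Suc k) d)" by (rule val_pos[of top_digit]) (use dd d in auto)
    ultimately have "0 < real (d k) - real (c k) + val q (shift (Suc k) d) - val q (shift (Suc k) c)"
      using k(1) by linarith
    then show False using val_diff[OF c(1) dd(1) k(2)] dd(2) c(3) q by simp
  qed
  then have "(THE c. expansion q x c \<and> infinite_seq c \<and>
      (\<forall>d. expansion q x d \<and> infinite_seq d \<longrightarrow> d \<sqsubseteq> c)) = c"
    using c expansion_iff[of x c] by (intro the_equality) (blast intro: lex.order.antisym)+
  then show ?thesis using \<open>x \<noteq> 0\<close> unfolding quasi_greedy_def by simp
qed

lemma quasi_greedy_props:
  assumes "0 < x" "x \<le> top_digit / (q - 1)"
  shows "digits_le top_digit (quasi_greedy q x)" "infinite_seq (quasi_greedy q x)"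
    "val q (quasi_greedy q x) = x"
    "\<And>n. quasi_greedy q x n < top_digit \<Longrightarrow> val q (shift (Suc n) (quasi_greedy q x)) \<le> 1"
  using exists_quasi_greedy[OF assms] quasi_greedy_eqI by metis+

lemma alpha_0: "alpha q 0 = top_digit"
proof (rule ccontr)
  note props = quasi_greedy_props[OF zero_less_one top_digit_sum_ge, folded alpha_def]
  assume "alpha q 0 \<noteq> top_digit"
  then have less: "alpha q 0 < top_digit" using digits_leD[OF props(1), of 0] by simp
  then have "val q (shift (Suc 0) (alpha q)) \<le> 1" by (rule props(4))
  then have "val q (alpha q) \<le> (real (alpha q 0) + 1) / q"
    using val_split[OF props(1), of 1] q by (simp add: field_simps)
  also have "\<dots> < 1" using less top_digit(2) q by simp
  finally show False using props(3) by simp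
qed

lemma alpha_props:
  "digits_le (alpha q 0) (alpha q)" "infinite_seq (alpha q)" "val q (alpha q) = 1"
  "\<And>n. alpha q n < alpha q 0 \<Longrightarrow> val q (shift (Suc n) (alpha q)) \<le> 1"
  using quasi_greedy_props[OF zero_less_one top_digit_sum_ge] unfolding alpha_0 unfolding alpha_def
    by blast+

lemmas top_digit_alpha = top_digit[folded alpha_0]

section \<open>Parry's theorem\<close>

text \<open>
  A lexicographic bound on the tails after non-maximal digits bounds their values by 1. Let \<open>d\<close> be such
  a tail, smaller than \<open>b\<close>. At the first difference \<open>d\<close> has a non-maximal digit, so what follows is
  again such a tail; an excess over 1 of at most \<open>e\<close> for all these tails therefore improves to \<open>e / q\<close>,
  and iteration gives 0.
\<close>

lemma val_le_one_of_lex: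
  assumes c: "digits_le A c" and b: "digits_le A b" "val q b = 1"
    and lex: "\<And>n. c n < A \<Longrightarrow> shift (Suc n) c \<sqsubseteq> b" and n: "c n < A"
  shows "val q (shift (Suc n) c) \<le> 1"
proof -
  define E where "E = A / (q - 1)"
  have "E \<ge> 0" unfolding E_def using q by simp
  have approx: "\<forall>n. c n < A \<longrightarrow> val q (shift (Suc n) c) \<le> 1 + E / q ^ j" for j
  proof (induction j)
    case 0
    have "val q (shift n c) \<le> 1 + E" for n
      using val_le[OF digits_le_shift[OF c], of n] unfolding E_def by linarith
    then show ?case by (metis div_by_1 power_0)
  next
    case (Suc j)
    show ?case
    proof (intro allI impI)
      fix n assume n: "c n < A"
      let ?d = "shift (Suc n) c"
      consider "?d = b" | "?d \<sqsubset> b" using lex[OF n] unfolding lex_le_def by blast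
      then show "val q ?d \<le> 1 + E / q ^ Suc j"
      proof cases
        case 1
        then show ?thesis using b(2) \<open>E \<ge> 0\<close> q by simp
      next
        case 2
        then obtain k where k: "?d k < b k" "\<forall>i<k. ?d i = b i" by (auto elim!: less_funE)
        have "c (Suc n + k) < A" using k(1) digits_leD[OF b(1), of k] by simp
        then have "val q (shift (Suc k) ?d) \<le> 1 + E / q ^ j"
          using Suc.IH unfolding shift_shift by (metis add_Suc_right)
        moreover have "0 \<le> val q (shift (Suc k) b)" by (rule val_nonneg[of A]) (use b in simp)
        ultimately have "- (E / q ^ j) \<le> real (b k) - real (?d k) + val q (shift (Suc k) b) - val q (shift (Suc k) ?d)"
          using k(1) by linarith
        then have "- (E / q ^ j) / q ^ Suc k \<le> val q b - val q ?d"
          unfolding val_diff[OF digits_le_shift[OF c] b(1) k(2)] using q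
          by (intro divide_right_mono) auto
        moreover have "E / q ^ j / q ^ Suc k \<le> E / q ^ j / q"
        proof (rule divide_left_mono)
          show "q \<le> q ^ Suc k" using q self_le_power[of q "Suc k"] by simp
        qed (use q \<open>E \<ge> 0\<close> in auto)
        ultimately show ?thesis using b(2) by (simp add: field_simps)
      qed
    qed
  qed
  have "(\<lambda>j. 1 + E * (1 / q) ^ j) \<longlonglongrightarrow> 1 + 0"
    using q by (intro tendsto_intros tendsto_mult_right_zero LIMSEQ_power_zero) simp
  then show ?thesis using approx n
    by (intro LIMSEQ_le_const[of "\<lambda>j. 1 + E * (1 / q) ^ j"]) (auto simp: power_one_over)
qed

lemma val_less_one_of_lex:
  assumes c: "digits_le A c" and b: "digits_le A b" "val q b = 1" "infinite_seq b"
    and lex: "\<And>n. c n < A \<Longrightarrow> shift (Suc n) c \<sqsubset> b" and n: "c n < A"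
  shows "val q (shift (Suc n) c) < 1"
proof -
  let ?d = "shift (Suc n) c"
  obtain k where k: "?d k < b k" "\<forall>i<k. ?d i = b i" using lex[OF n] by (auto elim!: less_funE)
  have "c (Suc n + k) < A" using k(1) digits_leD[OF b(1), of k] by simp
  then have "val q (shift (Suc k) ?d) \<le> 1"
    using val_le_one_of_lex[OF c b(1,2)] lex by (simp add: lex_le_def)
  moreover have "0 < val q (shift (Suc k) b)" by (rule val_pos[of A]) (use b in auto)
  ultimately have "0 < real (b k) - real (?d k) + val q (shift (Suc k) b) - val q (shift (Suc k) ?d)"
    using k(1) by linarith
  then have "0 < (real (b k) - real (?d k) + val q (shift (Suc k) b) - val q (shift (Suc k) ?d)) / q ^ Suc k"
    by (rule divide_pos_pos) (use q in simp)
  then have "0 < val q b - val q ?d" by (simp only: val_diff[OF digits_le_shift[OF c] b(1) k(2)])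
  then show ?thesis using b by simp
qed

lemma one_le_val_of_lex_less:
  assumes d: "digits_le (alpha q 0) d" and less: "alpha q \<sqsubset> d"
  shows "1 \<le> val q d" "infinite_seq d \<Longrightarrow> 1 < val q d"
proof -
  obtain k where k: "alpha q k < d k" "\<forall>i<k. alpha q i = d i" using less
    by (auto elim!: less_funE)
  have "val q (shift (Suc k) (alpha q)) \<le> 1"
    using alpha_props(4) k(1) digits_leD[OF d, of k] by simp
  then have *: "val q (shift (Suc k) d) \<le> real (d k) - real (alpha q k) + val q (shift (Suc k) d) - val q (shift (Suc k) (alpha q))"
    using k(1) by linarith
  have eq: "val q d - 1 = (real (d k) - real (alpha q k) + val q (shift (Suc k) d) - val q (shift (Suc k) (alpha q))) / q ^ Suc k"
    using val_diff[OF alpha_props(1) d k(2)] alpha_props(3) by simp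
  show "1 \<le> val q d"
  proof -
    have "0 \<le> val q (shift (Suc k) d)" by (rule val_nonneg[OF digits_le_shift[OF d]])
    then have "0 \<le> val q d - 1" unfolding eq using * q by (intro divide_nonneg_nonneg) auto
    then show ?thesis by simp
  qed
  show "1 < val q d" if "infinite_seq d"
  proof -
    have "0 < val q (shift (Suc k) d)" using that by (intro val_pos[OF digits_le_shift[OF d]]) simp
    then have "0 < val q d - 1" unfolding eq using * q by (intro divide_pos_pos) auto
    then show ?thesis by simp
  qed
qed

lemma lex_le_alphaI:
  assumes "digits_le (alpha q 0) d" "infinite_seq d" "val q d \<le> 1"
  shows "d \<sqsubseteq> alpha q"
  using one_le_val_of_lex_less(2)[of d] assms by (meson lex.not_le not_le)

lemma lex_less_alphaI:
  assumes "digits_le (alpha q 0) d" "val q d < 1"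
  shows "d \<sqsubset> alpha q"
proof (rule ccontr)
  assume "\<not> d \<sqsubset> alpha q"
  then consider "d = alpha q" | "alpha q \<sqsubset> d" using lex_trichotomy by blast
  then show False
    by cases (use assms alpha_props(3) one_le_val_of_lex_less(1)[of d] in auto)
qed

lemma shift_alpha_le: "shift k (alpha q) \<sqsubseteq> alpha q"
proof (cases "k = 0")
  case False
  consider m where "m < k" "alpha q m < alpha q 0" | "\<And>m. m < k \<Longrightarrow> alpha q m = alpha q 0"
    using digits_leD[OF alpha_props(1)] by (meson le_neq_implies_less)
  then show ?thesis
  proof cases
    case 1
    obtain n where n: "alpha q n < alpha q 0" "shift k (alpha q) \<sqsubseteq> shift (Suc n) (alpha q)"
      using shift_le_shift_after_small[OF alpha_props(1) 1(2,1)] by blast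
    have "shift (Suc n) (alpha q) \<sqsubseteq> alpha q"
      by (rule lex_le_alphaI) (use n(1) alpha_props in auto)
    then show ?thesis using n(2) lex.order_trans by blast
  next
    case 2
    have "j \<le> k \<Longrightarrow> shift j (alpha q) \<sqsubseteq> alpha q" for j
    proof (induction j)
      case (Suc j)
      then have "shift j (alpha q) \<sqsubseteq> alpha q" using Suc_leD by blast
      moreover have "shift (Suc j) (alpha q) \<sqsubseteq> shift j (alpha q)"
        by (rule shift_Suc_le_shift[OF alpha_props(1)], rule 2) (use Suc.prems in simp)
      ultimately show ?case using lex.order_trans by blast
    qed simp
    then show ?thesis by simp
  qed
qed simp

lemma quasi_greedy_iff:
  assumes c: "digits_le (alpha q 0) c" "infinite_seq c"
  shows "quasi_greedy q (val q c) = c \<longleftrightarrow> (\<forall>n. c n < alpha q 0 \<longrightarrow> shift (Suc n) c \<sqsubseteq> alpha q)"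
proof
  assume *: "quasi_greedy q (val q c) = c"
  have "0 < val q c" "val q c \<le> top_digit / (q - 1)"
    using val_pos[OF c] val_le[OF c(1)] alpha_0 by auto
  note props = quasi_greedy_props[OF this, unfolded *, folded alpha_0]
  show "\<forall>n. c n < alpha q 0 \<longrightarrow> shift (Suc n) c \<sqsubseteq> alpha q"
    using props c by (intro allI impI lex_le_alphaI) auto
next
  assume "\<forall>n. c n < alpha q 0 \<longrightarrow> shift (Suc n) c \<sqsubseteq> alpha q"
  then show "quasi_greedy q (val q c) = c"
    using c val_le_one_of_lex[OF c(1) alpha_props(1,3)]
    by (intro quasi_greedy_eqI) (auto simp: alpha_0)
qed

end

lemma alpha_strict_mono:
  assumes "1 < p" "p < q"
  shows "alpha p \<sqsubset> alpha q"
proof -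
  have p: "1 < p" and q: "1 < q" using assms by auto
  have dig: "digits_le (alpha q 0) (alpha p)"
  proof -
    have "alpha p 0 \<le> alpha q 0" using top_digit_alpha(2)[OF p] top_digit_alpha(3)[OF q] assms(2)
      by linarith
    then show ?thesis using alpha_props(1)[OF p] unfolding digits_le_def using order_trans by blast
  qed
  have "val q (alpha p) \<le> val p (alpha p) * (p / q)"
  proof (rule sums_le[OF _ val_sums[OF q dig] sums_mult2[OF val_sums[OF p alpha_props(1)[OF p]]]])
    fix i
    have "(p / q) ^ Suc i \<le> (p / q) ^ 1" using assms by (intro power_decreasing) auto
    then have "real (alpha p i) / p ^ Suc i * (p / q) ^ Suc i \<le> real (alpha p i) / p ^ Suc i * (p / q)"
      using p by (intro mult_left_mono) auto
    then show "real (alpha p i) / q ^ Suc i \<le> real (alpha p i) / p ^ Suc i * (p / q)"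
      using p by (simp add: power_divide)
  qed
  then have "val q (alpha p) < 1" using alpha_props(3)[OF p] assms
    by (smt (verit) divide_less_eq_1_pos mult_cancel_right1)
  then show ?thesis using lex_less_alphaI[OF q dig] by simp
qed

lemma lex_le_first: "c \<sqsubseteq> d \<Longrightarrow> c 0 \<le> d 0"
  unfolding lex_le_def less_fun_def by (metis gr0I less_imp_le order_refl)

text \<open>
  The series in \<open>r = 1 / q\<close> is continuous on the open unit interval, at most 1 at \<open>1 / (A + 1)\<close>, and at
  least 1 near 1 because two nonzero digits suffice there.
\<close>

lemma val_solvable:
  assumes a: "digits_le A a" "infinite_seq a"
  obtains q where "1 < q" "val q a = 1"
proof -
  define f where "f r = r * (\<Sum>i. real (a i) * r ^ i)" for r :: real
  have summ: "summable (\<lambda>i. real (a i) * r ^ i)" if "0 < r" "r < 1" for r :: real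
  proof (rule summable_comparison_test')
    show "summable (\<lambda>i. real A * r ^ i)" using that
      by (intro summable_mult summable_geometric) simp
    show "norm (real (a n) * r ^ n) \<le> real A * r ^ n" for n
      using that digits_leD[OF a(1), of n] by (simp add: mult_right_mono)
  qed
  have f_val: "f r = val (1 / r) a" if "0 < r" "r < 1" for r
    unfolding f_def val_def suminf_mult[OF summ[OF that], symmetric]
    by (intro suminf_cong) (use that in \<open>simp add: power_one_over divide_simps\<close>)
  have cont: "isCont f r" if "0 < r" "r < 1" for r
  proof -
    obtain K where "r < K" "K < 1" using \<open>r < 1\<close> dense by blast
    then have "isCont (\<lambda>x. \<Sum>i. real (a i) * x ^ i) r"
      using that summ[of K] by (intro isCont_powser[of _ K]) auto
    then show ?thesis unfolding f_def by (intro continuous_intros)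
  qed
  obtain i where i: "a i \<noteq> 0" using infinite_seqD[OF a(2), of 0] by blast
  obtain j where j: "j \<ge> Suc i" "a j \<noteq> 0" using infinite_seqD[OF a(2)] by blast
  define r0 where "r0 = 1 / (real A + 1)"
  \<comment> \<open>chosen such that \<open>r1 ^ Suc j \<ge> 1 / 2\<close> by Bernoulli's inequality\<close>
  define r1 where "r1 = 1 - 1 / (2 * (real j + 1))"
  have "A \<ge> 1" using i digits_leD[OF a(1), of i] by simp
  then have r0: "0 < r0" "r0 \<le> 1 / 2" unfolding r0_def by (simp_all add: field_simps)
  have r1: "1 / 2 \<le> r1" "r1 < 1" unfolding r1_def by (simp_all add: field_simps)
  have "f r0 \<le> 1"
    using val_le[of "real A + 1", OF _ a(1)] \<open>A \<ge> 1\<close> f_val[of r0] r0 unfolding r0_def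
      by simp
  moreover have "1 \<le> f r1"
  proof -
    have "1 + real (Suc j) * (- (1 / (2 * (real j + 1)))) \<le> (1 + - (1 / (2 * (real j + 1)))) ^ Suc j"
      by (rule Bernoulli_inequality) simp
    moreover have "real (Suc j) * (- (1 / (2 * (real j + 1)))) = - (1 / 2)" by (simp add: field_simps)
    ultimately have half: "1 / 2 \<le> r1 ^ Suc j" unfolding r1_def diff_conv_add_uminus by linarith
    have "r1 ^ Suc j \<le> real (a l) * r1 ^ Suc l" if "l \<in> {i, j}" for l
    proof -
      have "r1 ^ Suc j \<le> r1 ^ Suc l" using that j r1 by (intro power_decreasing) auto
      moreover have "1 * r1 ^ Suc l \<le> real (a l) * r1 ^ Suc l"
        using that i j r1 by (intro mult_right_mono) auto
      ultimately show ?thesis by linarith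
    qed
    from this[of i] this[of j] have "2 * r1 ^ Suc j \<le> real (a i) * r1 ^ Suc i + real (a j) * r1 ^ Suc j"
      by (simp del: power_Suc)
    also have "\<dots> = (\<Sum>l\<in>{i, j}. real (a l) * r1 ^ Suc l)" using j(1) by simp
    also have "\<dots> \<le> (\<Sum>l<Suc j. real (a l) * r1 ^ Suc l)"
      using j(1) r1 by (intro sum_mono2) auto
    also have "\<dots> = (\<Sum>l<Suc j. real (a l) / (1 / r1) ^ Suc l)" by (simp add: power_one_over)
    also have "\<dots> \<le> val (1 / r1) a"
      using val_split[of "1 / r1", OF _ a(1), of "Suc j"] val_nonneg[of "1 / r1", OF _ digits_le_shift[OF a(1)], of "Suc j"] r1
      by simp
    finally show ?thesis using half f_val[of r1] r1 by simp
  qed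
  ultimately obtain r where r: "r0 \<le> r" "r \<le> r1" "f r = 1"
    using IVT[of f r0 1 r1] cont r0 r1 by (metis le_less_trans less_le_trans order_trans)
  show thesis
    by (rule that[of "1 / r"]) (use r r0 r1 f_val[of r] in auto)
qed

text \<open>
  Every infinite sequence that dominates all its tails is \<open>alpha q\<close> for some base \<open>q\<close>.
\<close>

lemma alpha_surj:
  assumes inf: "infinite_seq a" and le: "\<And>k. shift k a \<sqsubseteq> a"
  obtains q where "1 < q" "alpha q = a"
proof -
  define A where "A = a 0"
  have dig: "digits_le A a"
    unfolding digits_le_def A_def using lex_le_first[OF le] by simp
  obtain q where q: "1 < q" and v: "val q a = 1" using val_solvable[OF dig inf] by blast
  have "val q a = real A / q + val q (shift 1 a) / q"
    using val_split[OF q dig, of 1] by (simp add: A_def)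
  moreover have "0 < val q (shift 1 a) / q"
    using val_pos[OF q digits_le_shift[OF dig], of 1] inf q by simp
  ultimately have "real A < q" using v q by (simp add: field_simps)
  moreover have "q \<le> real A + 1" using val_le[OF q dig] v q by (simp add: field_simps)
  ultimately have "top_digit q = A"
    using less_base_iff[OF q, of A] top_digit[OF q] by linarith
  then have "alpha q = a" unfolding alpha_def using dig inf v val_le_one_of_lex[OF q dig dig v le]
    by (intro quasi_greedy_eqI[OF q]) auto
  then show thesis using that q by blast
qed

lemma alpha_less_iff:
  assumes "1 < p" "1 < q"
  shows "alpha p \<sqsubset> alpha q \<longleftrightarrow> p < q"
  using alpha_strict_mono[of p q] alpha_strict_mono[of q p] assms
  by (metis less_fun_asym less_fun_irrefl linorder_neqE_linordered_idom)

lemma alpha_le_iff: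
  assumes "1 < p" "1 < q"
  shows "alpha p \<sqsubseteq> alpha q \<longleftrightarrow> p \<le> q"
  using alpha_less_iff[OF assms(2,1)] by (simp add: lex.not_less[symmetric] not_less[symmetric])

section \<open>Unique expansions\<close>

lemma val_less_of_small_tails:
  assumes q: "q > 1" and c: "digits_le (alpha q 0) c" and d: "digits_le (alpha q 0) d"
    and small: "\<And>n. c n < alpha q 0 \<Longrightarrow> shift (Suc n) c \<sqsubset> alpha q" and "c \<sqsubset> d"
  shows "val q c < val q d"
proof -
  obtain k where k: "c k < d k" "\<forall>i<k. c i = d i" using \<open>c \<sqsubset> d\<close>
    by (auto elim!: less_funE)
  have "val q (shift (Suc k) c) < 1"
    using val_less_one_of_lex[OF q c alpha_props(1,3,2)[OF q] small] k(1) digits_leD[OF d, of k] by simp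
  moreover have "0 \<le> val q (shift (Suc k) d)" by (rule val_nonneg[OF q digits_le_shift[OF d]])
  ultimately have "0 < real (d k) - real (c k) + val q (shift (Suc k) d) - val q (shift (Suc k) c)"
    using k(1) by linarith
  then have "0 < val q d - val q c" unfolding val_diff[OF q c d k(2)] using q
    by (intro divide_pos_pos) auto
  then show ?thesis by simp
qed

text \<open>
  If the tail after a digit \<open>c n < alpha q 0\<close> had value at least 1, the digit could be increased by one
  and the tail replaced by an expansion of its value minus 1.
\<close>

lemma unique_small_tails:
  assumes q: "q > 1" and c: "digits_le (alpha q 0) c"
    and unique: "\<And>d. digits_le (alpha q 0) d \<Longrightarrow> val q d = val q c \<Longrightarrow> d = c"
    and n: "c n < alpha q 0"
  shows "shift (Suc n) c \<sqsubset> alpha q"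
proof (rule lex_less_alphaI[OF q digits_le_shift[OF c]], rule ccontr)
  define y where "y = val q (shift (Suc n) c) - 1"
  assume "\<not> val q (shift (Suc n) c) < 1"
  then have y: "0 \<le> y" "y \<le> top_digit q / (q - 1)"
    using val_le[OF q digits_le_shift[OF c], of "Suc n"] unfolding y_def alpha_0[OF q] by linarith+
  obtain e where e: "digits_le (alpha q 0) e" "val q e = y"
  proof (cases "y = 0")
    case True
    then show thesis using that[of "\<lambda>_. 0"] by (simp add: digits_le_def val_def)
  next
    case False
    then show thesis using that exists_quasi_greedy[OF q, of y] y unfolding alpha_0[OF q] by auto
  qed
  define d where "d i = (if i < n then c i else if i = n then Suc (c n) else e (i - Suc n))" for i
  have dig: "digits_le (alpha q 0) d"
    using c e(1) n unfolding digits_le_def d_def by (auto simp: Suc_le_eq)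
  have "shift (Suc n) d = e" by (rule ext) (simp add: d_def)
  then have "val q d - val q c = 0"
    using val_diff[OF q c dig, of n] e(2) by (simp add: d_def y_def)
  then have "d = c" using unique[OF dig] by simp
  moreover have "d n = Suc (c n)" by (simp add: d_def)
  ultimately show False by simp
qed

text \<open>
  The lexicographic characterization of unique expansions. The condition after positive digits is the
  one after non-maximal digits for the complementary expansion.
\<close>

lemma unique_iff:
  assumes q: "q > 1" and c: "digits_le (alpha q 0) c"
  shows "(\<forall>d. digits_le (alpha q 0) d \<and> val q d = val q c \<longrightarrow> d = c) \<longleftrightarrow>
    (\<forall>n. c n < alpha q 0 \<longrightarrow> shift (Suc n) c \<sqsubset> alpha q) \<and>
    (\<forall>n. 0 < c n \<longrightarrow> compl_seq (alpha q 0) (shift (Suc n) c) \<sqsubset> alpha q)" (is "?L \<longleftrightarrow> ?R")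
proof
  let ?A = "alpha q 0" let ?c = "compl_seq ?A c"
  assume u: ?L
  have "d = ?c" if d: "digits_le ?A d" "val q d = val q ?c" for d
  proof -
    have "val q (compl_seq ?A d) = val q c" using d val_compl[OF q] c by simp
    then have "compl_seq ?A d = c" using u digits_le_compl by blast
    then show ?thesis using compl_compl[OF d(1)] by simp
  qed
  then have *: "?c n < ?A \<Longrightarrow> shift (Suc n) ?c \<sqsubset> alpha q" for n
    by (rule unique_small_tails[OF q digits_le_compl])
  have "compl_seq ?A (shift (Suc n) c) \<sqsubset> alpha q" if "0 < c n" for n
    using *[of n] that digits_leD[OF c, of n] by (simp add: shift_compl)
  moreover have "shift (Suc n) c \<sqsubset> alpha q" if "c n < ?A" for n
    by (rule unique_small_tails[OF q c _ that]) (use u in blast)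
  ultimately show ?R by blast
next
  let ?A = "alpha q 0" let ?c = "compl_seq ?A c"
  assume r: ?R
  have small: "shift (Suc n) ?c \<sqsubset> alpha q" if "?c n < ?A" for n
  proof -
    have "0 < c n" using that by (cases "c n") auto
    then show ?thesis using r by (simp add: shift_compl)
  qed
  show ?L
  proof (intro allI impI, elim conjE)
    fix d assume d: "digits_le ?A d" "val q d = val q c"
    show "d = c"
    proof (rule ccontr)
      assume "d \<noteq> c"
      then consider "c \<sqsubset> d" | "?c \<sqsubset> compl_seq ?A d"
        using lex_trichotomy compl_less_iff[OF c d(1)] by blast
      then show False
      proof cases
        case 1
        then show False using val_less_of_small_tails[OF q c d(1)] r d(2) by simp
      next
        case 2
        then have "val q ?c < val q (compl_seq ?A d)"
          using val_less_of_small_tails[OF q digits_le_compl digits_le_compl small] by blast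
        then show False using val_compl[OF q] c d by simp
      qed
    qed
  qed
qed

lemma expansion_alpha_iff:
  assumes "q > 1"
  shows "expansion q x c \<longleftrightarrow> digits_le (alpha q 0) c \<and> val q c = x"
  using expansion_iff[OF assms] alpha_0[OF assms] by simp

lemma quasi_greedy_expansion:
  assumes q: "q > 1" and "digits_le (alpha q 0) e"
  shows "expansion q (val q e) (quasi_greedy q (val q e))"
proof (cases "val q e = 0")
  case True
  then show ?thesis unfolding expansion_alpha_iff[OF q]
    by (simp add: quasi_greedy_def digits_le_def val_def)
next
  case False
  then have "0 < val q e" "val q e \<le> top_digit q / (q - 1)"
    using val_nonneg[OF q assms(2)] val_le[OF q assms(2)] alpha_0[OF q] by auto
  then show ?thesis using quasi_greedy_props[OF q] unfolding expansion_iff[OF q] by blast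
qed

lemma U_seqs_iff:
  assumes q: "q > 1"
  shows "c \<in> U_seqs q \<longleftrightarrow> digits_le (alpha q 0) c \<and>
    (\<forall>n. c n < alpha q 0 \<longrightarrow> shift (Suc n) c \<sqsubset> alpha q) \<and>
    (\<forall>n. 0 < c n \<longrightarrow> compl_seq (alpha q 0) (shift (Suc n) c) \<sqsubset> alpha q)" (is "_ \<longleftrightarrow> ?R")
proof
  assume "c \<in> U_seqs q"
  then obtain x where ex1: "\<exists>!e. expansion q x e" and c: "c = quasi_greedy q x"
    unfolding U_seqs_def U_base_def by blast
  then have "expansion q x c"
    using quasi_greedy_expansion[OF q] unfolding expansion_alpha_iff[OF q] by blast
  then have "digits_le (alpha q 0) c" "\<forall>d. digits_le (alpha q 0) d \<and> val q d = val q c \<longrightarrow> d = c"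
    using ex1 unfolding expansion_alpha_iff[OF q] by blast+
  then show ?R using unique_iff[OF q] by blast
next
  assume r: ?R
  then have "\<forall>d. digits_le (alpha q 0) d \<and> val q d = val q c \<longrightarrow> d = c"
    using unique_iff[OF q] by blast
  then have "\<exists>!e. expansion q (val q c) e" "quasi_greedy q (val q c) = c"
    using r quasi_greedy_expansion[OF q, of c] unfolding expansion_alpha_iff[OF q] by blast+
  then show "c \<in> U_seqs q" unfolding U_seqs_def U_base_def
    by (intro image_eqI[of _ _ "val q c"]) simp_all
qed

lemma U_iff_alpha_in_U_seqs:
  assumes q: "q > 1"
  shows "q \<in> U \<longleftrightarrow> alpha q \<in> U_seqs q"
proof
  assume "q \<in> U"
  then have "1 \<in> U_base q" unfolding U_def U_base_def by blast
  then show "alpha q \<in> U_seqs q" unfolding U_seqs_def alpha_def by (rule imageI)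
next
  assume "alpha q \<in> U_seqs q"
  then have "\<forall>d. digits_le (alpha q 0) d \<and> val q d = val q (alpha q) \<longrightarrow> d = alpha q"
    using unique_iff[OF q alpha_props(1)[OF q]] U_seqs_iff[OF q] by blast
  then have "\<exists>!e. expansion q 1 e"
    unfolding expansion_alpha_iff[OF q] using alpha_props(1,3)[OF q] by metis
  then show "q \<in> U" unfolding U_def using q by simp
qed

lemma U_iff:
  assumes q: "q > 1"
  shows "q \<in> U \<longleftrightarrow> (\<forall>n. alpha q n < alpha q 0 \<longrightarrow> shift (Suc n) (alpha q) \<noteq> alpha q) \<and>
    (\<forall>k\<ge>1. compl_seq (alpha q 0) (shift k (alpha q)) \<sqsubset> alpha q)" (is "_ \<longleftrightarrow> ?R")
proof
  let ?A = "alpha q 0" let ?c = "compl_seq ?A (alpha q)"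
  assume "q \<in> U"
  then have u: "\<forall>n. alpha q n < ?A \<longrightarrow> shift (Suc n) (alpha q) \<sqsubset> alpha q"
    "\<forall>n. 0 < alpha q n \<longrightarrow> compl_seq ?A (shift (Suc n) (alpha q)) \<sqsubset> alpha q"
    using U_iff_alpha_in_U_seqs[OF q] U_seqs_iff[OF q] by auto
  have "compl_seq ?A (shift k (alpha q)) \<sqsubset> alpha q" if "k \<ge> 1" for k
  proof -
    have "?c 0 < ?A" using top_digit_alpha(1)[OF q] by simp
    moreover have "0 < k" using that by simp
    ultimately obtain n where n: "?c n < ?A" "shift k ?c \<sqsubseteq> shift (Suc n) ?c"
      using shift_le_shift_after_small[OF digits_le_compl, of ?A "alpha q" 0 k] by blast
    have "0 < alpha q n" using n(1) by (cases "alpha q n") auto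
    then show ?thesis using u(2) n(2) lex.le_less_trans unfolding shift_compl by blast
  qed
  then show ?R using u(1) less_fun_irrefl by metis
next
  assume r: ?R
  then have "shift (Suc n) (alpha q) \<sqsubset> alpha q" if "alpha q n < alpha q 0" for n
    using shift_alpha_le[OF q, of "Suc n"] that unfolding lex_le_def by blast
  moreover have "compl_seq (alpha q 0) (shift (Suc n) (alpha q)) \<sqsubset> alpha q" for n
    using r by (simp only: le_add1 plus_1_eq_Suc[symmetric])
  ultimately have "alpha q \<in> U_seqs q"
    unfolding U_seqs_iff[OF q] using alpha_props(1)[OF q] by blast
  then show "q \<in> U" using U_iff_alpha_in_U_seqs[OF q] by blast
qed

lemma V_iff: "q \<in> V \<longleftrightarrow> q > 1 \<and> (\<forall>k\<ge>1. compl_seq (alpha q 0) (shift k (alpha q)) \<sqsubseteq> alpha q)"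
  unfolding V_def reflection_def compl_seq_def shift_def by simp

lemma U_subset_V: "U \<subseteq> V"
proof
  fix q assume "q \<in> U"
  moreover then have "q > 1" unfolding U_def by simp
  ultimately show "q \<in> V" using U_iff unfolding V_iff lex_le_def by blast
qed

lemma V_seqs_iff:
  assumes q: "q > 1"
  shows "c \<in> V_seqs q \<longleftrightarrow> digits_le (alpha q 0) c \<and> (infinite_seq c \<or> c = (\<lambda>_. 0)) \<and>
    (\<forall>n. c n < alpha q 0 \<longrightarrow> shift (Suc n) c \<sqsubseteq> alpha q) \<and>
    (\<forall>n. 0 < c n \<longrightarrow> compl_seq (alpha q 0) (shift (Suc n) c) \<sqsubseteq> alpha q)" (is "_ \<longleftrightarrow> ?R")
proof -
  have tails: "x \<in> V_base q \<longleftrightarrow> 0 \<le> x \<and> x \<le> top_digit q / (q - 1) \<and>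
    (\<forall>n. 0 < quasi_greedy q x n \<longrightarrow> compl_seq (alpha q 0) (shift (Suc n) (quasi_greedy q x)) \<sqsubseteq> alpha q)" for x
  proof -
    have "(\<forall>n\<ge>1. P (n - 1) n) \<longleftrightarrow> (\<forall>n. P n (Suc n))" for P :: "nat \<Rightarrow> nat \<Rightarrow> bool"
    proof (intro iffI allI impI)
      fix n assume "\<forall>n\<ge>1. P (n - 1) n"
      from this[rule_format, of "Suc n"] show "P n (Suc n)" by simp
    next
      fix n :: nat assume "\<forall>n. P n (Suc n)" "n \<ge> 1"
      from this(1)[rule_format, of "n - 1"] this(2) show "P (n - 1) n" by simp
    qed
    note shift_index = this[of "\<lambda>m n. quasi_greedy q x m > 0 \<longrightarrow> compl_seq (alpha q 0) (shift n (quasi_greedy q x)) \<sqsubseteq> alpha q"]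
    have refl: "reflection q (\<lambda>i. quasi_greedy q x (n + i)) = compl_seq (alpha q 0) (shift n (quasi_greedy q x))" for n
      by (simp only: reflection_def compl_seq_def shift_def)
    show ?thesis
      unfolding V_base_def J_def real_of_top_digit[OF q] mem_Collect_eq atLeastAtMost_iff refl shift_index
      by (rule conj_assoc)
  qed
  show ?thesis
  proof
    assume "c \<in> V_seqs q"
    then obtain x where x: "x \<in> V_base q" and c: "c = quasi_greedy q x" unfolding V_seqs_def by blast
    show ?R
    proof (cases "x = 0")
      case True
      then have "c = (\<lambda>_. 0)" using c by (simp add: quasi_greedy_def)
      moreover have "shift n (\<lambda>_. 0) \<sqsubset> alpha q" for n
        unfolding less_fun_def using top_digit_alpha(1)[OF q] by (intro exI[of _ 0]) simp
      ultimately show ?thesis unfolding digits_le_def lex_le_def by blast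
    next
      case False
      then have "0 < x" "x \<le> top_digit q / (q - 1)" using x[unfolded tails] by linarith+
      note props = quasi_greedy_props[OF q this, folded c alpha_0[OF q]]
      have "quasi_greedy q (val q c) = c" by (simp only: props(3) c[symmetric])
      then have "\<forall>n. c n < alpha q 0 \<longrightarrow> shift (Suc n) c \<sqsubseteq> alpha q"
        using quasi_greedy_iff[OF q props(1,2)] by blast
      then show ?thesis using props(1,2) x unfolding tails c[symmetric] by blast
    qed
  next
    assume r: ?R
    show "c \<in> V_seqs q"
    proof (cases "c = (\<lambda>_. 0)")
      case True
      then have 0: "c = quasi_greedy q 0" by (simp add: quasi_greedy_def)
      moreover have "0 \<in> V_base q" unfolding tails 0[symmetric] True using q by simp
      ultimately show ?thesis unfolding V_seqs_def by blast
    next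
      case False
      then have "quasi_greedy q (val q c) = c" using r quasi_greedy_iff[OF q] by blast
      moreover have "0 \<le> val q c" using r val_nonneg[OF q] by blast
      moreover have "val q c \<le> top_digit q / (q - 1)" using r val_le[OF q] unfolding alpha_0[OF q]
        by blast
      ultimately have "val q c \<in> V_base q" unfolding tails using r by metis
      then show ?thesis unfolding V_seqs_def
        using \<open>quasi_greedy q (val q c) = c\<close> by (intro image_eqI[of _ _ "val q c"]) simp_all
    qed
  qed
qed

section \<open>Self-bounded sequences\<close>

text \<open>
  The lexicographic conditions satisfied by \<open>alpha p\<close> for \<open>p \<in> V\<close> with top digit \<open>A\<close>. For \<open>A \<ge> 1\<close>
  such sequences are infinite, and they are exactly these \<open>alpha p\<close>
  (lemmas \<open>alpha_in_self_bounded\<close> and \<open>self_bounded_imp_alpha\<close> below).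
\<close>

definition self_bounded :: "nat \<Rightarrow> (nat \<Rightarrow> nat) set" where
  "self_bounded A = {a. digits_le A a \<and> a 0 = A \<and> (\<forall>k. shift k a \<sqsubseteq> a) \<and>
    (\<forall>k\<ge>1. compl_seq A (shift k a) \<sqsubseteq> a)}"

lemma compl_less_self:
  assumes "a 0 = A" "1 \<le> A"
  shows "compl_seq A a \<sqsubset> a"
  unfolding less_fun_def using assms by (intro exI[of _ 0]) simp

lemma self_boundedD:
  assumes "a \<in> self_bounded A"
  shows "digits_le A a" "a 0 = A" "shift k a \<sqsubseteq> a" "k \<ge> 1 \<Longrightarrow> compl_seq A (shift k a) \<sqsubseteq> a"
  using assms unfolding self_bounded_def by blast+

lemma self_bounded_compl_le:
  assumes "a \<in> self_bounded A" "1 \<le> A"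
  shows "compl_seq A (shift k a) \<sqsubseteq> a"
proof (cases "k = 0")
  case True
  then show ?thesis using compl_less_self[of a A] self_boundedD(2)[OF assms(1)] assms(2)
    by (simp add: lex_le_def)
qed (use self_boundedD(4)[OF assms(1), of k] in simp)

lemma const_le_imp_eq:
  assumes "digits_le A a" "(\<lambda>_. A) \<sqsubseteq> a"
  shows "a = (\<lambda>_. A)"
  using assms digits_leD[OF assms(1)] unfolding lex_le_def less_fun_def by (metis leD)

lemma not_infinite_seqE:
  assumes "\<not> infinite_seq c"
  obtains n where "\<And>m. n \<le> m \<Longrightarrow> shift m c = (\<lambda>_. 0)"
proof -
  obtain n where n: "\<forall>i\<ge>n. c i = 0" using assms infinite_seqI by blast
  show thesis by (rule that[of n], rule ext) (use n in simp)
qed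

lemma self_bounded_infinite:
  assumes "a \<in> self_bounded A" "1 \<le> A"
  shows "infinite_seq a"
proof (rule ccontr)
  assume "\<not> infinite_seq a"
  then obtain n where n: "\<And>m. n \<le> m \<Longrightarrow> shift m a = (\<lambda>_. 0)"
    using not_infinite_seqE by blast
  have "compl_seq A (shift n a) = (\<lambda>_. A)" using n[of n] by (simp add: compl_seq_def)
  then have "a = (\<lambda>_. A)"
    using const_le_imp_eq self_boundedD(1)[OF assms(1)] self_bounded_compl_le[OF assms, of n] by simp
  then show False using fun_cong[OF n[of n], of 0] assms(2) by simp
qed

lemma self_bounded_closed:
  assumes "digits_le A t" and approx: "\<And>m. \<exists>a\<in>self_bounded A. \<forall>i<m. a i = t i"
  shows "t \<in> self_bounded A"
proof -
  obtain a where "a \<in> self_bounded A" "a 0 = t 0" using approx[of 1] by auto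
  then have "t 0 = A" using self_boundedD(2)[of a A] by simp
  moreover have "shift k t \<sqsubseteq> t" for k
  proof (rule lex_le_limit)
    fix m
    obtain a where a: "a \<in> self_bounded A" "\<forall>i<k + m. a i = t i" using approx by blast
    then show "\<exists>c' d'. (\<forall>i<m. c' i = shift k t i) \<and> (\<forall>i<m. d' i = t i) \<and> c' \<sqsubseteq> d'"
      using self_boundedD(3)[OF a(1), of k] by (intro exI[of _ "shift k a"] exI[of _ a]) auto
  qed
  moreover have "compl_seq A (shift k t) \<sqsubseteq> t" if "k \<ge> 1" for k
  proof (rule lex_le_limit)
    fix m
    obtain a where a: "a \<in> self_bounded A" "\<forall>i<k + m. a i = t i" using approx by blast
    then show "\<exists>c' d'. (\<forall>i<m. c' i = compl_seq A (shift k t) i) \<and> (\<forall>i<m. d' i = t i) \<and> c' \<sqsubseteq> d'"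
      using self_boundedD(4)[OF a(1) that]
        by (intro exI[of _ "compl_seq A (shift k a)"] exI[of _ a]) auto
  qed
  ultimately show ?thesis using assms(1) unfolding self_bounded_def by blast
qed

section \<open>Good prefixes and approximation from below\<close>

text \<open>
  \<open>c\<close> is lexicographically smaller than \<open>d\<close>, and this shows within the first \<open>m\<close> digits.
\<close>

definition less_within :: "nat \<Rightarrow> (nat \<Rightarrow> nat) \<Rightarrow> (nat \<Rightarrow> nat) \<Rightarrow> bool" where
  "less_within m c d \<longleftrightarrow> (\<exists>k<m. c k < d k \<and> (\<forall>i<k. c i = d i))"

lemma less_within_imp_less: "less_within m c d \<Longrightarrow> c \<sqsubset> d"
  unfolding less_within_def less_fun_def by blast

lemma less_within_mono: "less_within m c d \<Longrightarrow> m \<le> n \<Longrightarrow> less_within n c d"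
  unfolding less_within_def by (meson less_le_trans)

lemma less_within_cong:
  assumes "less_within m c d" "\<And>i. i < m \<Longrightarrow> c' i = c i" "\<And>i. i < m \<Longrightarrow> d' i = d i"
  shows "less_within m c' d'"
  using assms unfolding less_within_def by (metis order.strict_trans)

lemma less_imp_less_within: "c \<sqsubset> d \<Longrightarrow> \<exists>m. less_within m c d"
  unfolding less_within_def less_fun_def by blast

text \<open>
  The prefix of length \<open>m\<close> of \<open>b\<close> is good if the complement of each of its nonempty suffixes is strictly
  smaller than the prefix of \<open>b\<close> of the same length.
\<close>

definition good_prefix :: "nat \<Rightarrow> (nat \<Rightarrow> nat) \<Rightarrow> nat \<Rightarrow> bool" where
  "good_prefix A b m \<longleftrightarrow> (\<forall>i<m. less_within (m - i) (compl_seq A (shift i b)) b)"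

text \<open>
  Self-bounded sequences no proper tail of which has complement equal to the sequence itself. For
  \<open>q \<in> V\<close> this condition on \<open>alpha q\<close> will characterize the closure of \<open>U\<close>.
\<close>

definition strictly_self_bounded :: "nat \<Rightarrow> (nat \<Rightarrow> nat) \<Rightarrow> bool" where
  "strictly_self_bounded A b \<longleftrightarrow> b \<in> self_bounded A \<and> 1 \<le> A \<and> (\<forall>k\<ge>1. compl_seq A (shift k b) \<sqsubset> b)"

lemma strictly_self_bounded_compl_less:
  assumes "strictly_self_bounded A b"
  shows "compl_seq A (shift k b) \<sqsubset> b"
proof (cases "k = 0")
  case True
  then show ?thesis using assms compl_less_self[of b A] self_boundedD(2)[of b A]
    unfolding strictly_self_bounded_def by simp
qed (use assms in \<open>simp add: strictly_self_bounded_def\<close>)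

text \<open>
  Choose \<open>m\<close> so large that the condition holds for all suffixes starting at \<open>i \<le> N\<close>. If the prefix of
  length \<open>m\<close> is not good and \<open>i\<close> is the first place where the condition fails, then \<open>i > N\<close> and the
  prefix of length \<open>i\<close> is good.
\<close>

lemma ex_good_prefix:
  assumes b: "strictly_self_bounded A b"
  shows "\<exists>m>N. good_prefix A b m"
proof -
  have bW: "b \<in> self_bounded A" using b unfolding strictly_self_bounded_def by blast
  obtain K where K: "\<And>i. less_within (K i) (compl_seq A (shift i b)) b"
    using less_imp_less_within[OF strictly_self_bounded_compl_less[OF b]] by metis
  define m where "m = Suc N + (\<Sum>i\<le>N. K i)"
  have early: "less_within (m - i) (compl_seq A (shift i b)) b" if "i \<le> N" for i
  proof (rule less_within_mono[OF K])
    have "K i \<le> (\<Sum>i\<le>N. K i)" using that by (intro member_le_sum) auto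
    then show "K i \<le> m - i" using that unfolding m_def by simp
  qed
  show ?thesis
  proof (cases "good_prefix A b m")
    case True
    then show ?thesis unfolding m_def by (intro exI[of _ "Suc N + (\<Sum>i\<le>N. K i)"]) simp
  next
    case False
    let ?bad = "\<lambda>i. i < m \<and> \<not> less_within (m - i) (compl_seq A (shift i b)) b"
    define i where "i = (LEAST i. ?bad i)"
    have ex: "\<exists>i. ?bad i" using False unfolding good_prefix_def by blast
    have i: "i < m" "\<not> less_within (m - i) (compl_seq A (shift i b)) b"
      using LeastI_ex[OF ex] unfolding i_def by blast+
    have min: "less_within (m - i') (compl_seq A (shift i' b)) b" if "i' < i" for i'
      using not_less_Least[of i' ?bad] that i(1) unfolding i_def[symmetric] by simp
    have agree: "compl_seq A (shift i b) l = b l" if "l < m - i" for l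
    proof -
      obtain k where k: "compl_seq A (shift i b) k < b k" "\<forall>l<k. compl_seq A (shift i b) l = b l"
        using strictly_self_bounded_compl_less[OF b, of i] unfolding less_fun_def by blast
      then have "\<not> k < m - i" using i(2) unfolding less_within_def by blast
      then show ?thesis using k(2) that by simp
    qed
    have "good_prefix A b i" unfolding good_prefix_def
    proof (intro allI impI)
      fix i' assume "i' < i"
      obtain k where k: "k < m - i'" "compl_seq A (shift i' b) k < b k"
          "\<forall>l<k. compl_seq A (shift i' b) l = b l"
        using min[OF \<open>i' < i\<close>] unfolding less_within_def by blast
      \<comment> \<open>otherwise the digits from \<open>i\<close> to \<open>m\<close>, whose complement is a prefix of \<open>b\<close>, make a tail of \<open>b\<close> exceed \<open>b\<close>\<close>
      have "k < i - i'"
      proof (rule ccontr)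
        assume "\<not> k < i - i'"
        define r where "r = i - i'"
        have r: "r \<le> k" "i = i' + r" using \<open>\<not> k < i - i'\<close> \<open>i' < i\<close>
          unfolding r_def by auto
        have "b (k - r) = compl_seq A (shift i b) (k - r)"
          using agree[of "k - r"] k(1) r i(1) by simp
        also have "\<dots> = compl_seq A (shift i' b) k" using r by simp
        finally have lt: "b (k - r) < shift r b (k - r)" using k(2) r by simp
        have eq: "b l = shift r b l" if "l < k - r" for l
        proof -
          have "b l = compl_seq A (shift i b) l" using agree[of l] k(1) r i(1) that by simp
          also have "\<dots> = compl_seq A (shift i' b) (r + l)" using r by (simp add: add.assoc)
          also have "\<dots> = shift r b l" using k(3) that by simp
          finally show ?thesis .
        qed
        have "b \<sqsubset> shift r b" unfolding less_fun_def using lt eq by blast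
        then show False using self_boundedD(3)[OF bW, of r] by (simp add: lex.not_le[symmetric])
      qed
      then show "less_within (i - i') (compl_seq A (shift i' b)) b"
        using k unfolding less_within_def by blast
    qed
    moreover have "N < i" using early i(2) by (meson not_le)
    ultimately show ?thesis by blast
  qed
qed

text \<open>
  If \<open>u\<close> is a good prefix of \<open>b\<close>, the periodic sequence in which \<open>u\<close> alternates with its complement is
  self-bounded and smaller than \<open>b\<close>.
\<close>

lemma self_bounded_antiperiodic_below:
  assumes b: "strictly_self_bounded A b" and good: "good_prefix A b m" and "1 \<le> m"
  obtains c where "c \<in> self_bounded A" "c \<sqsubset> b" "\<And>i. i < m \<Longrightarrow> c i = b i"
proof -
  have bW: "b \<in> self_bounded A" and A: "1 \<le> A" using b unfolding strictly_self_bounded_def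
    by auto
  define c where "c i = (if even (i div m) then b (i mod m) else A - b (i mod m))" for i
  have cb: "c i = b i" if "i < m" for i using that by (simp add: c_def)
  have dig: "digits_le A c" using digits_leD[OF self_boundedD(1)[OF bW]] unfolding digits_le_def c_def
    by simp
  have anti: "shift m c = compl_seq A c"
    by (rule ext) (use \<open>1 \<le> m\<close> digits_leD[OF self_boundedD(1)[OF bW]] in \<open>auto simp: c_def\<close>)
  have c0: "c 0 = A" using cb[of 0] \<open>1 \<le> m\<close> self_boundedD(2)[OF bW] by simp
  have compl_c: "compl_seq A (shift k c) \<sqsubset> c" if "k < m" for k
  proof (rule less_within_imp_less, rule less_within_cong)
    show "less_within (m - k) (compl_seq A (shift k b)) b" using good that unfolding good_prefix_def
      by blast
  qed (auto simp: cb)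
  have shift_c: "shift k c \<sqsubseteq> c" if "k < m" for k
  proof (cases "k = 0")
    case False
    show ?thesis
    proof (rule ccontr)
      assume "\<not> shift k c \<sqsubseteq> c"
      then obtain j where j: "c j < c (k + j)" "\<And>i. i < j \<Longrightarrow> c i = c (k + i)"
        by (auto simp: lex.not_le elim!: less_funE)
      show False
      proof (cases "k + j < m")
        case True
        have "b j < b (k + j)" using j(1) cb[of j] cb[of "k + j"] True by simp
        moreover have "b i = b (k + i)" if "i < j" for i
          using j(2)[OF that] cb[of i] cb[of "k + i"] True that by simp
        ultimately have "b \<sqsubset> shift k b" unfolding less_fun_def by (intro exI[of _ j]) simp
        then show False using self_boundedD(3)[OF bW, of k] by (simp add: lex.not_le[symmetric])
      next
        case False
        have "c \<sqsubset> shift k c" using \<open>\<not> shift k c \<sqsubseteq> c\<close>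
          by (simp add: lex.not_le)
        then have "shift (m - k) c \<sqsubset> shift (m - k) (shift k c)"
          using j(2) False by (subst shift_less_iff) auto
        also have "shift (m - k) (shift k c) = compl_seq A c" using that anti by simp
        finally have "shift (m - k) c \<sqsubset> compl_seq A c" .
        then have "c \<sqsubset> compl_seq A (shift (m - k) c)"
          using compl_less_iff[OF digits_le_compl[of A c] digits_le_shift[OF dig, of "m - k"]] dig
            by simp
        then show False using compl_c[of "m - k"] \<open>k \<noteq> 0\<close> that less_fun_asym
          by fastforce
      qed
    qed
  qed simp
  have tails: "shift k c \<sqsubseteq> c \<and> compl_seq A (shift k c) \<sqsubseteq> c" for k
  proof (induction k rule: less_induct)
    case (less k)
    show ?case
    proof (cases "k < m")
      case True
      then show ?thesis using shift_c compl_c unfolding lex_le_def by blast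
    next
      case False
      then have "shift k c = shift (k - m) (shift m c)" by simp
      then have eq: "shift k c = compl_seq A (shift (k - m) c)" unfolding anti shift_compl .
      have "k - m < k" using False \<open>1 \<le> m\<close> by simp
      then show ?thesis
        unfolding eq compl_compl[OF digits_le_shift[OF dig]] using less by blast
    qed
  qed
  have "c \<in> self_bounded A" unfolding self_bounded_def using dig c0 tails by blast
  moreover have "c \<sqsubset> b"
  proof (rule ccontr)
    assume "\<not> c \<sqsubset> b"
    then have "b \<sqsubseteq> c" by (simp add: lex.not_less)
    then have "shift m b \<sqsubseteq> compl_seq A c" unfolding anti[symmetric] using cb
      by (subst shift_le_iff) auto
    then have "c \<sqsubseteq> compl_seq A (shift m b)"
      using compl_le_iff[OF digits_le_compl[of A c] digits_le_shift[OF self_boundedD(1)[OF bW], of m]] dig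
        by simp
    also have "compl_seq A (shift m b) \<sqsubset> b" by (rule strictly_self_bounded_compl_less[OF b])
    finally show False using \<open>b \<sqsubseteq> c\<close> by (simp add: lex.not_le[symmetric])
  qed
  ultimately show thesis using that cb by blast
qed

lemma periodic_shift_mod:
  assumes "shift P b = b"
  shows "shift k b = shift (k mod P) b"
proof (induction k rule: less_induct)
  case (less k)
  show ?case
  proof (cases "P = 0 \<or> k < P")
    case False
    then have "shift k b = shift (k - P) (shift P b)" by simp
    then show ?thesis using less[of "k - P"] False assms by (simp add: le_mod_geq)
  qed auto
qed

text \<open>
  A periodic strictly self-bounded sequence \<open>b\<close> is approximated from below by sequences \<open>a\<close> that satisfy
  the strict inequalities for tails as well: a long good prefix of \<open>b\<close> is followed by the complement of an
  antiperiodic sequence \<open>c < b\<close>. By periodicity there is one length \<open>L\<close> within which the complements of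
  all tails of \<open>b\<close> are smaller than \<open>b\<close>, and \<open>c\<close> is taken to agree with \<open>b\<close> up to this length.
\<close>

lemma strictly_self_bounded_aperiodic_below:
  assumes b: "strictly_self_bounded A b" and periodic: "shift P b = b" "1 \<le> P"
  obtains a where "strictly_self_bounded A a" "\<And>k. k \<ge> 1 \<Longrightarrow> shift k a \<sqsubset> a" "a \<sqsubset> b" "\<And>i. i < N \<Longrightarrow> a i = b i"
proof -
  have bW: "b \<in> self_bounded A" and A: "1 \<le> A" using b unfolding strictly_self_bounded_def
    by auto
  note dig_b = self_boundedD(1)[OF bW]
  obtain K where K: "\<And>i. less_within (K i) (compl_seq A (shift i b)) b"
    using less_imp_less_within[OF strictly_self_bounded_compl_less[OF b]] by metis
  define L where "L = (\<Sum>i<P. K i)"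
  have L: "less_within L (compl_seq A (shift k b)) b" for k
  proof -
    have "less_within L (compl_seq A (shift (k mod P) b)) b"
      by (rule less_within_mono[OF K]) (use periodic(2) in \<open>auto simp: L_def intro!: member_le_sum\<close>)
    then show ?thesis using periodic_shift_mod[OF periodic(1), of k] by simp
  qed
  obtain m where m: "m > L" "good_prefix A b m" using ex_good_prefix[OF b] by blast
  obtain c where c: "c \<in> self_bounded A" "c \<sqsubset> b" "\<And>i. i < m \<Longrightarrow> c i = b i"
    using self_bounded_antiperiodic_below[OF b m(2)] m(1) by auto
  note dig_c = self_boundedD(1)[OF c(1)]
  obtain d where d: "less_within d c b" using less_imp_less_within[OF c(2)] by blast
  obtain M where M: "M > N + d" "good_prefix A b M" using ex_good_prefix[OF b] by blast
  define a where "a i = (if i < M then b i else A - c (i - M))" for i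
  have ab: "a i = b i" if "i < M" for i using that by (simp add: a_def)
  have tail_a: "shift M a = compl_seq A c" by (rule ext) (simp add: a_def)
  have dig_a: "digits_le A a" using digits_leD[OF dig_b] unfolding digits_le_def a_def by simp
  have a0: "a 0 = A" using ab[of 0] M(1) self_boundedD(2)[OF bW] by simp
  have ca: "c \<sqsubset> a"
    by (rule less_within_imp_less[of d], rule less_within_cong[OF d]) (use M(1) ab in auto)
  have late: "shift k a \<sqsubset> a" "compl_seq A (shift k a) \<sqsubset> a" if "M \<le> k" for k
  proof -
    have "shift k a = shift (k - M) (shift M a)" using that by simp
    then have *: "shift k a = compl_seq A (shift (k - M) c)" unfolding tail_a shift_compl .
    show "shift k a \<sqsubset> a"
      unfolding * using self_bounded_compl_le[OF c(1) A] ca lex.le_less_trans by blast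
    show "compl_seq A (shift k a) \<sqsubset> a"
      unfolding * compl_compl[OF digits_le_shift[OF dig_c]]
      using self_boundedD(3)[OF c(1)] ca lex.le_less_trans by blast
  qed
  have compl_a: "compl_seq A (shift k a) \<sqsubset> a" if "k < M" for k
  proof (rule less_within_imp_less, rule less_within_cong)
    show "less_within (M - k) (compl_seq A (shift k b)) b"
      using M(2) that unfolding good_prefix_def by blast
  qed (auto simp: ab)
  have shift_a: "shift k a \<sqsubset> a" if "1 \<le> k" "k < M" for k
  proof (rule ccontr)
    define r where "r = M - k"
    have r: "r < M" "k + r = M" "M - r = k" "r + k = M" using that unfolding r_def by auto
    assume "\<not> shift k a \<sqsubset> a"
    then have le: "a \<sqsubseteq> shift k a" by (simp add: lex.not_less)
    have agree: "a i = shift k a i" if "i < r" for i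
    proof (rule ccontr)
      assume ne: "a i \<noteq> shift k a i"
      then have "a \<noteq> shift k a" by metis
      then obtain j where j: "a j < a (k + j)" "\<And>i. i < j \<Longrightarrow> a i = a (k + i)"
        using le unfolding lex_le_def by (auto elim!: less_funE)
      then have "k + j < M" using ne that r(2)
        by (metis add_less_cancel_left leI order.strict_trans1 shift_apply)
      have "b j < b (k + j)" using j(1) ab[of j] ab[of "k + j"] \<open>k + j < M\<close> by simp
      moreover have "b l = b (k + l)" if "l < j" for l
        using j(2)[OF that] ab[of l] ab[of "k + l"] \<open>k + j < M\<close> that by simp
      ultimately have "b \<sqsubset> shift k b" unfolding less_fun_def by (intro exI[of _ j]) simp
      then show False using self_boundedD(3)[OF bW, of k] by (simp add: lex.not_le[symmetric])
    qed
    have "shift r a \<sqsubseteq> shift r (shift k a)" using le agree by (subst shift_le_iff) auto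
    then have "shift r a \<sqsubseteq> compl_seq A c" using r tail_a by simp
    then have c_le: "c \<sqsubseteq> compl_seq A (shift r a)"
      using compl_le_iff[OF digits_le_compl[of A c] digits_le_shift[OF dig_a, of r]] dig_c by simp
    \<comment> \<open>only \<open>k\<close> digits of \<open>b\<close> remain in \<open>a\<close> after position \<open>r\<close>; goodness of the prefix helps if \<open>k < L\<close>\<close>
    have "less_within (min k L) (compl_seq A (shift r b)) b"
    proof (cases "k < L")
      case True
      then show ?thesis using M(2) r unfolding good_prefix_def by (metis min.absorb3)
    next
      case False
      then show ?thesis using L[of r] by (simp add: min_absorb2)
    qed
    then have "less_within (min k L) (compl_seq A (shift r a)) c"
      by (rule less_within_cong) (use r m(1) in \<open>auto simp: ab c(3)\<close>)
    then show False using c_le less_within_imp_less by (simp add: lex.not_le[symmetric])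
  qed
  have tails: "shift k a \<sqsubset> a" "compl_seq A (shift k a) \<sqsubset> a" if "k \<ge> 1" for k
    using shift_a[of k] compl_a[of k] late[of k] that by (meson not_le)+
  have "shift k a \<sqsubseteq> a" for k
    using tails(1)[of k] by (cases "k = 0") (auto simp: lex_le_def)
  then have "strictly_self_bounded A a"
    unfolding strictly_self_bounded_def self_bounded_def using tails(2) dig_a a0 A
      by (auto simp: lex_le_def)
  moreover have "a \<sqsubset> b"
  proof -
    have "less_within L (compl_seq A (shift M b)) c"
      by (rule less_within_cong[OF L]) (use m(1) c(3) in auto)
    then have "compl_seq A (shift M b) \<sqsubset> c" by (rule less_within_imp_less)
    then have "compl_seq A c \<sqsubset> shift M b"
      using compl_less_iff[OF dig_c digits_le_compl[of A "shift M b"]]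
        compl_compl[OF digits_le_shift[OF dig_b, of M]] by metis
    then show ?thesis unfolding tail_a[symmetric] using ab by (subst (asm) shift_less_iff) auto
  qed
  ultimately show thesis using that tails(1) ab M(1) by simp
qed

section \<open>Suprema of tails\<close>

text \<open>
  The sequences that have to be compared with \<open>alpha q\<close> in the characterizations of \<open>U_seqs q\<close> and
  \<open>V_seqs q\<close>, where \<open>A = alpha q 0\<close>.
\<close>

definition tails :: "nat \<Rightarrow> (nat \<Rightarrow> nat) \<Rightarrow> (nat \<Rightarrow> nat) set" where
  "tails A c = {shift (Suc n) c | n. c n < A} \<union> {compl_seq A (shift (Suc n) c) | n. 0 < c n}"

lemma tails_compl:
  assumes "digits_le A c"
  shows "tails A (compl_seq A c) = tails A c"
proof -
  have "A - c n < A \<longleftrightarrow> 0 < c n" "0 < A - c n \<longleftrightarrow> c n < A" for n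
    using digits_leD[OF assms, of n] by auto
  then show ?thesis unfolding tails_def using assms by (auto simp: shift_compl)
qed

lemma digits_le_tails: "digits_le A c \<Longrightarrow> s \<in> tails A c \<Longrightarrow> digits_le A s"
  unfolding tails_def by auto

text \<open>
  Tails of elements of \<open>tails A c\<close>, and their complements, are again bounded by such elements. For
  complements a positive first digit is needed: an initial block of zeros of \<open>c\<close> carries no condition.
\<close>

lemma tails_dominate:
  assumes c: "digits_le A c" and s: "s \<in> tails A c"
  shows "\<exists>s'\<in>tails A c. shift k s \<sqsubseteq> s'"
    and "0 < s 0 \<Longrightarrow> 1 \<le> k \<Longrightarrow> \<exists>s'\<in>tails A c. compl_seq A (shift k s) \<sqsubseteq> s'"
proof -
  have *: "\<exists>s'\<in>tails A c. shift k s \<sqsubseteq> s'"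
      "0 < s 0 \<Longrightarrow> 1 \<le> k \<Longrightarrow> \<exists>s'\<in>tails A c. compl_seq A (shift k s) \<sqsubseteq> s'"
    if c: "digits_le A c" and s: "s = shift (Suc n) c" "c n < A" for c n
  proof -
    have "n < Suc n + k" by simp
    then obtain n' where "c n' < A" "shift (Suc n + k) c \<sqsubseteq> shift (Suc n') c"
      using shift_le_shift_after_small[OF c s(2)] by blast
    then show "\<exists>s'\<in>tails A c. shift k s \<sqsubseteq> s'"
      unfolding tails_def s(1) shift_shift by blast
    assume "0 < s 0" "1 \<le> k"
    then have "compl_seq A c (Suc n) < A" "Suc n < Suc n + k"
      using s(1) digits_leD[OF c, of "Suc n"] by auto
    then obtain n' where n': "compl_seq A c n' < A"
        "shift (Suc n + k) (compl_seq A c) \<sqsubseteq> shift (Suc n') (compl_seq A c)"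
      using shift_le_shift_after_small[OF digits_le_compl] by blast
    have "0 < c n'" using n'(1) by (cases "c n'") auto
    then show "\<exists>s'\<in>tails A c. compl_seq A (shift k s) \<sqsubseteq> s'"
      using n'(2) unfolding tails_def s(1) shift_shift shift_compl by blast
  qed
  consider n where "s = shift (Suc n) c" "c n < A" | n where "s = compl_seq A (shift (Suc n) c)" "0 < c n"
    using s unfolding tails_def by blast
  then have "(\<exists>s'\<in>tails A c. shift k s \<sqsubseteq> s') \<and>
    (0 < s 0 \<longrightarrow> 1 \<le> k \<longrightarrow> (\<exists>s'\<in>tails A c. compl_seq A (shift k s) \<sqsubseteq> s'))"
  proof cases
    case 1
    from *[OF c this] show ?thesis by blast
  next
    case 2
    then have "s = shift (Suc n) (compl_seq A c)" "compl_seq A c n < A"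
      using digits_leD[OF c, of n] by (auto simp: shift_compl)
    from *[OF digits_le_compl this] show ?thesis unfolding tails_compl[OF c] by blast
  qed
  then show "\<exists>s'\<in>tails A c. shift k s \<sqsubseteq> s'"
    and "0 < s 0 \<Longrightarrow> 1 \<le> k \<Longrightarrow> \<exists>s'\<in>tails A c. compl_seq A (shift k s) \<sqsubseteq> s'"
      by blast+
qed

lemma sup_tails_in_self_bounded:
  assumes c: "digits_le A c" and A: "1 \<le> A" and t: "digits_le A t" "t 0 = A"
    and upper: "\<And>s. s \<in> tails A c \<Longrightarrow> s \<sqsubseteq> t"
    and approx: "\<And>m. \<exists>s\<in>tails A c. \<forall>i<m. s i = t i"
  shows "t \<in> self_bounded A"
proof -
  have "shift k t \<sqsubseteq> t" for k
  proof (rule lex_le_limit)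
    fix m
    obtain s where s: "s \<in> tails A c" "\<forall>i<k + m. s i = t i" using approx by blast
    have "shift k s \<sqsubseteq> t" using tails_dominate(1)[OF c s(1)] upper lex.order_trans by blast
    then show "\<exists>c' d'. (\<forall>i<m. c' i = shift k t i) \<and> (\<forall>i<m. d' i = t i) \<and> c' \<sqsubseteq> d'"
      using s(2) by (intro exI[of _ "shift k s"] exI[of _ t]) auto
  qed
  moreover have "compl_seq A (shift k t) \<sqsubseteq> t" if "k \<ge> 1" for k
  proof (rule lex_le_limit)
    fix m
    obtain s where s: "s \<in> tails A c" "\<forall>i<k + m. s i = t i" using approx by blast
    have "0 < s 0" using s(2) that t(2) A by simp
    then have "compl_seq A (shift k s) \<sqsubseteq> t"
      using tails_dominate(2)[OF c s(1) _ that] upper lex.order_trans by blast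
    then show "\<exists>c' d'. (\<forall>i<m. c' i = compl_seq A (shift k t) i) \<and> (\<forall>i<m. d' i = t i) \<and> c' \<sqsubseteq> d'"
      using s(2) by (intro exI[of _ "compl_seq A (shift k s)"] exI[of _ t]) auto
  qed
  ultimately show ?thesis unfolding self_bounded_def using t by blast
qed

lemma alpha_0_eq_iff:
  assumes "q > 1"
  shows "alpha q 0 = A \<longleftrightarrow> real A < q \<and> q \<le> real A + 1"
  using top_digit_alpha(2,3)[OF assms] by linarith

lemma V_gt_1: "p \<in> V \<Longrightarrow> 1 < p"
  by (simp add: V_iff)

lemma alpha_in_self_bounded:
  assumes "p \<in> V"
  shows "alpha p \<in> self_bounded (alpha p 0)"
  using assms alpha_props(1) shift_alpha_le unfolding V_iff self_bounded_def by blast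

lemma self_bounded_imp_alpha:
  assumes "a \<in> self_bounded A" "1 \<le> A"
  obtains p where "p \<in> V" "alpha p = a"
proof -
  obtain p where p: "1 < p" "alpha p = a"
    using alpha_surj[OF self_bounded_infinite[OF assms]] self_boundedD(3)[OF assms(1)] by blast
  then have "p \<in> V" unfolding V_iff using self_boundedD(2,4)[OF assms(1)] by simp
  then show thesis using that p by blast
qed

lemma integer_in_U:
  assumes "1 \<le> A"
  shows "real A + 1 \<in> U" "alpha (real A + 1) = (\<lambda>_. A)"
proof -
  have c: "compl_seq A (\<lambda>_. A) \<sqsubset> (\<lambda>_. A)" using assms
    by (intro compl_less_self) auto
  have sh: "shift k (\<lambda>_. A) = (\<lambda>_. A)" for k by (simp add: shift_def)
  have "(\<lambda>_. A) \<in> self_bounded A" unfolding self_bounded_def using c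
    by (simp add: sh digits_le_def lex_le_def)
  then obtain p where p: "p \<in> V" "alpha p = (\<lambda>_. A)" using self_bounded_imp_alpha assms
    by blast
  note p1 = V_gt_1[OF p(1)]
  have "(\<lambda>i. real A / p ^ Suc i) sums (A / (p - 1))" by (rule geometric_tail_sums[OF p1])
  moreover have "(\<lambda>i. real (alpha p i) / p ^ Suc i) sums 1"
    using val_sums[OF p1 alpha_props(1)[OF p1]] alpha_props(3)[OF p1] by simp
  ultimately have "A / (p - 1) = 1" unfolding p(2) by (rule sums_unique2)
  then have "p = real A + 1" using p1 by (simp add: field_simps)
  moreover have "p \<in> U" unfolding U_iff[OF p1] p(2) sh using c by simp
  ultimately show "real A + 1 \<in> U" "alpha (real A + 1) = (\<lambda>_. A)" using p(2) by auto
qed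

lemma integer_in_V: "1 \<le> A \<Longrightarrow> real A + 1 \<in> V"
  using integer_in_U(1) U_subset_V by blast

section \<open>The gaps of V\<close>

text \<open>
  The supremum of the elements of \<open>V\<close> below \<open>q\<close> with the same top digit, obtained as a lexicographic
  supremum. It is in \<open>V\<close>, and may be equal to \<open>q\<close>.
\<close>

lemma V_sup_below:
  assumes q: "1 < q" and A: "alpha q 0 = A" and S: "p0 \<in> V" "p0 < q" "alpha p0 0 = A"
  obtains r where "r \<in> V" "r \<le> q" "alpha r 0 = A" "\<And>p. p \<in> V \<Longrightarrow> p < q \<Longrightarrow> alpha p 0 = A \<Longrightarrow> p \<le> r"
    "\<And>m. \<exists>p\<in>V. p < q \<and> alpha p 0 = A \<and> (\<forall>i<m. alpha p i = alpha r i)"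
proof -
  define S where "S = {alpha p |p. p \<in> V \<and> p < q \<and> alpha p 0 = A}"
  have A1: "1 \<le> A" using top_digit_alpha(1)[OF q] A by simp
  have SW: "s \<in> self_bounded A" if "s \<in> S" for s using that alpha_in_self_bounded unfolding S_def
    by blast
  have "S \<noteq> {}" using S unfolding S_def by blast
  then obtain t where t: "\<And>s. s \<in> S \<Longrightarrow> s \<sqsubseteq> t" "\<And>m. \<exists>s\<in>S. \<forall>i<m. s i = t i" "digits_le A t"
    using lex_sup[of S A] self_boundedD(1)[OF SW] by metis
  have "t \<in> self_bounded A" using self_bounded_closed[OF t(3)] t(2) SW by meson
  then obtain r where r: "r \<in> V" "alpha r = t" using self_bounded_imp_alpha A1 by blast
  have "t \<sqsubseteq> alpha q"
  proof (rule lex_le_limit)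
    fix m
    obtain s where s: "s \<in> S" "\<forall>i<m. s i = t i" using t(2) by blast
    then have "s \<sqsubseteq> alpha q" unfolding S_def using alpha_strict_mono V_gt_1
      by (auto simp: lex_le_def)
    then show "\<exists>c' d'. (\<forall>i<m. c' i = t i) \<and> (\<forall>i<m. d' i = alpha q i) \<and> c' \<sqsubseteq> d'"
      using s(2) by blast
  qed
  then have "r \<le> q" using alpha_le_iff[OF V_gt_1[OF r(1)] q] r(2) by simp
  moreover have "p \<le> r" if "p \<in> V" "p < q" "alpha p 0 = A" for p
    using t(1)[of "alpha p"] that alpha_le_iff[OF V_gt_1[OF that(1)] V_gt_1[OF r(1)]] r(2)
    unfolding S_def by blast
  moreover have "\<exists>p\<in>V. p < q \<and> alpha p 0 = A \<and> (\<forall>i<m. alpha p i = alpha r i)" for m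
    using t(2)[of m] unfolding S_def r(2) by blast
  moreover have "alpha r 0 = A" using self_boundedD(2)[OF \<open>t \<in> self_bounded A\<close>] r(2)
    by simp
  ultimately show thesis using that r(1) by blast
qed

text \<open>
  The infimum of the elements of \<open>V\<close> above \<open>q\<close>. The base \<open>A + 1\<close> ensures that there are some with
  top digit \<open>A\<close>. The case \<open>q = 1\<close>, where \<open>alpha q\<close> has no meaning, gives the minimum of \<open>V\<close>.
\<close>

lemma V_inf_above:
  assumes q: "real A \<le> q" "q < real A + 1" and A1: "1 \<le> A"
  obtains r where "r \<in> V" "q \<le> r" "\<And>p. p \<in> V \<Longrightarrow> q < p \<Longrightarrow> r \<le> p"
    "\<And>m. \<exists>p\<in>V. q < p \<and> alpha p 0 = A \<and> (\<forall>i<m. alpha p i = alpha r i)"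
proof -
  define S where "S = {alpha p |p. p \<in> V \<and> q < p \<and> alpha p 0 = A}"
  have SW: "s \<in> self_bounded A" if "s \<in> S" for s using that alpha_in_self_bounded unfolding S_def
    by blast
  have int: "alpha (real A + 1) \<in> S"
    unfolding S_def mem_Collect_eq using integer_in_V[OF A1] integer_in_U(2)[OF A1] q
    by (intro exI[of _ "real A + 1"]) simp
  then have "S \<noteq> {}" by blast
  then obtain t where t: "\<And>s. s \<in> S \<Longrightarrow> t \<sqsubseteq> s" "\<And>m. \<exists>s\<in>S. \<forall>i<m. s i = t i" "digits_le A t"
    using lex_inf[of S A] self_boundedD(1)[OF SW] by metis
  have "t \<in> self_bounded A" using self_bounded_closed[OF t(3)] t(2) SW by meson
  then obtain r where r: "r \<in> V" "alpha r = t" using self_bounded_imp_alpha A1 by blast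
  note r1 = V_gt_1[OF r(1)]
  have "q \<le> r"
  proof (cases "q = 1")
    case False
    then have q1: "1 < q" using q A1 by linarith
    have "alpha q \<sqsubseteq> t"
    proof (rule lex_le_limit)
      fix m
      obtain s where s: "s \<in> S" "\<forall>i<m. s i = t i" using t(2) by blast
      then have "alpha q \<sqsubseteq> s" unfolding S_def using alpha_strict_mono q1
        by (auto simp: lex_le_def)
      then show "\<exists>c' d'. (\<forall>i<m. c' i = alpha q i) \<and> (\<forall>i<m. d' i = t i) \<and> c' \<sqsubseteq> d'"
        using s(2) by blast
    qed
    then show ?thesis using alpha_le_iff[OF q1 r1] r(2) by simp
  qed (use r1 in simp)
  moreover have "r \<le> p" if p: "p \<in> V" "q < p" for p
  proof (cases "p \<le> real A + 1")
    case True
    then have "alpha p 0 = A" using alpha_0_eq_iff[OF V_gt_1[OF p(1)]] p(2) q by simp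
    then show ?thesis using t(1)[of "alpha p"] p alpha_le_iff[OF r1 V_gt_1[OF p(1)]] r(2)
      unfolding S_def by blast
  next
    case False
    have "r \<le> real A + 1" using t(1)[OF int] alpha_le_iff[OF r1, of "real A + 1"] r(2) A1 by simp
    then show ?thesis using False by simp
  qed
  moreover have "\<exists>p\<in>V. q < p \<and> alpha p 0 = A \<and> (\<forall>i<m. alpha p i = alpha r i)" for m
    using t(2)[of m] unfolding S_def r(2) by blast
  ultimately show thesis using that r(1) by blast
qed

text \<open>
  The connected components of the complement of \<open>V\<close> in \<open>{1<..}\<close>, described by their endpoints; see
  \<open>V_gap_iff_component\<close> below.
\<close>

definition V_gap :: "real \<Rightarrow> real \<Rightarrow> bool" where
  "V_gap q1 q2 \<longleftrightarrow> q1 < q2 \<and> (q1 \<in> V \<or> q1 = 1) \<and> q2 \<in> V \<and> {q1<..<q2} \<inter> V = {}"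

lemma V_gap_left_ge_1: "V_gap q1 q2 \<Longrightarrow> 1 \<le> q1"
  unfolding V_gap_def using V_gt_1 by fastforce

lemma alpha_0_in_V_or_one:
  assumes "1 < q"
  shows "real (alpha q 0) \<in> V \<or> real (alpha q 0) = 1"
proof (cases "alpha q 0 = 1")
  case False
  then have "1 \<le> alpha q 0 - 1" "real (alpha q 0) = real (alpha q 0 - 1) + 1"
    using top_digit_alpha(1)[OF assms] by auto
  then show ?thesis using integer_in_V by metis
qed simp

text \<open>
  A base \<open>q\<close> that is outside \<open>V\<close>, or whose sequence \<open>alpha q\<close> is not approximated by those of smaller
  elements of \<open>V\<close>, is the right end of an interval free of elements of \<open>V\<close> that starts in \<open>V\<close> or at 1.
\<close>

lemma V_left_isolatedI:
  assumes q: "1 < q" and no_limit: "q \<in> V \<Longrightarrow>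
      (\<And>m. \<exists>p\<in>V. p < q \<and> alpha p 0 = alpha q 0 \<and> (\<forall>i<m. alpha p i = alpha q i)) \<Longrightarrow> False"
  obtains q1 where "q1 < q" "q1 \<in> V \<or> q1 = 1" "{q1<..<q} \<inter> V = {}"
proof (cases "\<exists>p\<in>V. p < q \<and> alpha p 0 = alpha q 0")
  case True
  then obtain r where r: "r \<in> V" "r \<le> q" "alpha r 0 = alpha q 0"
      "\<And>p. p \<in> V \<Longrightarrow> p < q \<Longrightarrow> alpha p 0 = alpha q 0 \<Longrightarrow> p \<le> r"
      "\<And>m. \<exists>p\<in>V. p < q \<and> alpha p 0 = alpha q 0 \<and> (\<forall>i<m. alpha p i = alpha r i)"
    using V_sup_below[OF q refl] by metis
  have "r \<noteq> q" using no_limit r(1,5) by blast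
  then have "r < q" using r(2) by simp
  moreover have "{r<..<q} \<inter> V = {}"
  proof (rule ccontr)
    assume "{r<..<q} \<inter> V \<noteq> {}"
    then obtain p where p: "p \<in> V" "r < p" "p < q" by auto
    then have "alpha p 0 = alpha q 0"
      using alpha_0_eq_iff[OF V_gt_1[OF p(1)], of "alpha q 0"] alpha_0_eq_iff[OF q, of "alpha q 0"]
        alpha_0_eq_iff[OF V_gt_1[OF r(1)], of "alpha q 0"] r(3) by linarith
    then show False using r(4)[OF p(1,3)] p(2) by simp
  qed
  ultimately show thesis using that r(1) by blast
next
  case False
  have "real (alpha q 0) < q" using top_digit_alpha(2)[OF q] .
  moreover have "{real (alpha q 0)<..<q} \<inter> V = {}"
  proof (rule ccontr)
    assume "{real (alpha q 0)<..<q} \<inter> V \<noteq> {}"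
    then obtain p where p: "p \<in> V" "real (alpha q 0) < p" "p < q" by auto
    then have "alpha p 0 = alpha q 0"
      using alpha_0_eq_iff[OF V_gt_1[OF p(1)], of "alpha q 0"] top_digit_alpha(3)[OF q] by linarith
    then show False using False p by blast
  qed
  ultimately show thesis using that alpha_0_in_V_or_one[OF q] by blast
qed

lemma ex_V_gap:
  assumes "1 < q" "q \<notin> V"
  obtains q1 q2 where "V_gap q1 q2" "q1 < q" "q < q2"
proof -
  obtain q1 where q1: "q1 < q" "q1 \<in> V \<or> q1 = 1" "{q1<..<q} \<inter> V = {}"
    using V_left_isolatedI[OF assms(1)] assms(2) by metis
  define A where "A = nat \<lfloor>q\<rfloor>"
  have A: "real A \<le> q" "q < real A + 1" "1 \<le> A" using assms(1) unfolding A_def by linarith+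
  obtain q2 where q2: "q2 \<in> V" "q \<le> q2" "\<And>p. p \<in> V \<Longrightarrow> q < p \<Longrightarrow> q2 \<le> p"
    using V_inf_above[OF A] by metis
  have "q < q2" using q2(1,2) assms(2) by (metis order_le_less)
  moreover have "{q1<..<q2} \<inter> V = {}"
  proof (rule ccontr)
    assume "{q1<..<q2} \<inter> V \<noteq> {}"
    then obtain p where p: "p \<in> V" "q1 < p" "p < q2" by auto
    then show False using q1(3) q2(3)[of p] assms(2)
      by (metis IntI empty_iff greaterThanLessThan_iff linorder_neqE_linordered_idom not_le)
  qed
  ultimately show thesis using that[of q1 q2] q1(1,2) q2(1) unfolding V_gap_def by force
qed

lemma V_bounded_below:
  obtains r where "1 < r" "V \<subseteq> {r..}"
proof -
  have "real 1 \<le> (1 :: real)" "1 < real 1 + 1" "1 \<le> (1 :: nat)" by auto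
  then obtain r where "r \<in> V" "\<And>p. p \<in> V \<Longrightarrow> 1 < p \<Longrightarrow> r \<le> p"
    using V_inf_above by metis
  then show thesis using that[of r] V_gt_1 by auto
qed

lemma closure_U_subset_V: "closure U \<subseteq> V"
proof
  fix q assume q: "q \<in> closure U"
  obtain r where r: "1 < r" "V \<subseteq> {r..}" using V_bounded_below by blast
  have "closure U \<subseteq> {r..}" using r(2) U_subset_V by (intro closure_minimal) auto
  then have "1 < q" using q r(1) by auto
  show "q \<in> V"
  proof (rule ccontr)
    assume "q \<notin> V"
    then obtain q1 q2 where g: "V_gap q1 q2" "q1 < q" "q < q2" using ex_V_gap \<open>1 < q\<close>
      by blast
    then have "{q1<..<q2} \<inter> U = {}" using U_subset_V unfolding V_gap_def by blast
    then have "{q1<..<q2} \<inter> closure U = {}" using open_Int_closure_eq_empty[of "{q1<..<q2}" U]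
      by simp
    then show False using q g by auto
  qed
qed

section \<open>The closure of U\<close>

lemma strictly_self_bounded_alpha_iff:
  assumes "q \<in> V"
  shows "strictly_self_bounded (alpha q 0) (alpha q) \<longleftrightarrow> (\<forall>k\<ge>1. compl_seq (alpha q 0) (shift k (alpha q)) \<noteq> alpha q)"
  using assms alpha_in_self_bounded[OF assms] top_digit_alpha(1)[OF V_gt_1[OF assms]]
  unfolding strictly_self_bounded_def V_iff lex_le_def using less_fun_irrefl by metis

lemma U_imp_strictly_self_bounded: "q \<in> U \<Longrightarrow> strictly_self_bounded (alpha q 0) (alpha q)"
  using U_subset_V alpha_in_self_bounded[of q] top_digit_alpha(1)[of q] U_iff[of q] V_gt_1[of q]
  unfolding strictly_self_bounded_def by blast

text \<open>
  Let \<open>b = alpha q\<close> be equal to the complement of its tail after \<open>k\<close> digits. If \<open>p \<in> V\<close>, \<open>p < q\<close> and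
  \<open>alpha p\<close> agreed with \<open>b\<close> on \<open>k\<close> digits, then the complement of the tail of \<open>alpha p\<close> would be smaller
  than that of \<open>b\<close>, forcing \<open>alpha p > b\<close>.
\<close>

lemma V_left_isolated:
  assumes q: "q \<in> V" and "\<not> strictly_self_bounded (alpha q 0) (alpha q)"
  obtains q1 where "q1 < q" "q1 \<in> V \<or> q1 = 1" "{q1<..<q} \<inter> V = {}"
proof -
  let ?A = "alpha q 0"
  obtain k where k: "k \<ge> 1" "compl_seq ?A (shift k (alpha q)) = alpha q"
    using strictly_self_bounded_alpha_iff assms by blast
  have False if limit: "\<And>m. \<exists>p\<in>V. p < q \<and> alpha p 0 = ?A \<and> (\<forall>i<m. alpha p i = alpha q i)"
  proof -
    obtain p where p: "p \<in> V" "p < q" "alpha p 0 = ?A" "\<forall>i<k. alpha p i = alpha q i"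
      using limit by blast
    have less: "alpha p \<sqsubset> alpha q" using alpha_strict_mono V_gt_1 p by blast
    have "compl_seq ?A (shift k (alpha p)) \<sqsubseteq> alpha p"
      using self_boundedD(4)[OF alpha_in_self_bounded[OF p(1)] k(1)] p(3) by simp
    also have "alpha p \<sqsubset> compl_seq ?A (shift k (alpha q))" using less k(2) by simp
    finally have "shift k (alpha q) \<sqsubset> shift k (alpha p)"
      using compl_less_iff[of ?A "shift k (alpha p)" "shift k (alpha q)"]
        alpha_props(1)[OF V_gt_1[OF q]] alpha_props(1)[OF V_gt_1[OF p(1)]] p(3) by simp
    then have "alpha q \<sqsubset> alpha p" using p(4) by (subst (asm) shift_less_iff) auto
    then show False using less less_fun_asym by blast
  qed
  then show thesis using V_left_isolatedI[OF V_gt_1[OF q]] that by metis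
qed

text \<open>
  Under the same condition \<open>alpha q\<close> has period \<open>2 * k\<close>. If \<open>alpha p\<close> is larger but agrees with \<open>alpha q\<close>
  on a period, then deleting this period moves the first difference to the left, so that a tail of
  \<open>alpha p\<close> exceeds \<open>alpha p\<close>.
\<close>

lemma V_right_isolated:
  assumes q: "q \<in> V" and strict: "\<not> strictly_self_bounded (alpha q 0) (alpha q)"
  obtains r where "q < r" "{q<..<r} \<inter> V = {}"
proof -
  let ?A = "alpha q 0" let ?b = "alpha q"
  note q1 = V_gt_1[OF q]
  have A1: "1 \<le> ?A" using top_digit_alpha(1)[OF q1] .
  obtain k where k: "k \<ge> 1" "compl_seq ?A (shift k ?b) = ?b"
    using strictly_self_bounded_alpha_iff assms by blast
  have dig: "digits_le ?A (shift k ?b)" using alpha_props(1)[OF q1] by simp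
  have "shift k ?b = compl_seq ?A ?b" using k(2) compl_compl[OF dig] by simp
  then have "shift k (shift k ?b) = ?b" using k(2) by (simp only: shift_compl)
  then have periodic: "?b (k + k + i) = ?b i" for i by (metis shift_apply shift_shift)
  have "q \<noteq> real ?A + 1"
    using integer_in_U(1)[OF A1] U_imp_strictly_self_bounded strict by metis
  then have "q < real ?A + 1" using top_digit_alpha(3)[OF q1] by simp
  moreover have "real ?A \<le> q" using top_digit_alpha(2)[OF q1] by simp
  ultimately obtain r where r: "r \<in> V" "q \<le> r" "\<And>p. p \<in> V \<Longrightarrow> q < p \<Longrightarrow> r \<le> p"
    "\<And>m. \<exists>p\<in>V. q < p \<and> alpha p 0 = ?A \<and> (\<forall>i<m. alpha p i = alpha r i)"
    using V_inf_above A1 by metis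
  have "r \<noteq> q"
  proof
    assume "r = q"
    then obtain p where p: "p \<in> V" "q < p" "\<forall>i<k + k. alpha p i = ?b i" using r(4) by blast
    have "?b \<sqsubset> alpha p" using alpha_strict_mono[OF q1 p(2)] .
    then obtain j where j: "?b j < alpha p j" "\<And>i. i < j \<Longrightarrow> ?b i = alpha p i"
      by (auto elim!: less_funE)
    then have "k + k \<le> j" using p(3) by (metis less_irrefl not_le)
    define n where "n = j - (k + k)"
    have n: "j = k + k + n" "n < j" using \<open>k + k \<le> j\<close> k(1) unfolding n_def by auto
    have "alpha p \<sqsubset> shift (k + k) (alpha p)" unfolding less_fun_def
    proof (intro exI conjI allI impI)
      show "alpha p n < shift (k + k) (alpha p) n"
        using j(1) j(2)[OF n(2)] periodic[of n] n(1) by simp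
      fix i assume "i < n"
      then show "alpha p i = shift (k + k) (alpha p) i"
        using j(2)[of i] j(2)[of "k + k + i"] periodic[of i] n by simp
    qed
    then show False using shift_alpha_le[OF V_gt_1[OF p(1)], of "k + k"]
      by (simp add: lex.not_le[symmetric])
  qed
  then have "q < r" using r(2) by simp
  moreover have "{q<..<r} \<inter> V = {}" using r(3) by fastforce
  ultimately show thesis using that by blast
qed

text \<open>
  A smaller sequence that agrees with \<open>alpha q\<close> for long enough comes from a base close to \<open>q\<close>.
\<close>

lemma between_of_prefix:
  assumes "1 < q'" "q' < q"
  obtains N where "\<And>p. 1 < p \<Longrightarrow> alpha p \<sqsubset> alpha q \<Longrightarrow> (\<And>i. i < N \<Longrightarrow> alpha p i = alpha q i) \<Longrightarrow> q' < p \<and> p < q"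
proof -
  obtain N where N: "less_within N (alpha q') (alpha q)"
    using less_imp_less_within alpha_strict_mono[OF assms] by blast
  show thesis
  proof (rule that[of N])
    fix p assume p: "1 < p" "alpha p \<sqsubset> alpha q" "\<And>i. i < N \<Longrightarrow> alpha p i = alpha q i"
    have "alpha q' \<sqsubset> alpha p"
      by (rule less_within_imp_less, rule less_within_cong[OF N]) (use p(3) in auto)
    then show "q' < p \<and> p < q" using alpha_less_iff p assms by simp
  qed
qed

lemma V_left_limit:
  assumes q: "q \<in> V" and strict: "strictly_self_bounded (alpha q 0) (alpha q)" and "q' < q"
  shows "\<exists>p\<in>V. q' < p \<and> p < q"
proof -
  note q1 = V_gt_1[OF q]
  define q'' where "q'' = max q' ((1 + q) / 2)"
  have q'': "1 < q''" "q'' < q" "q' \<le> q''" unfolding q''_def using q1 \<open>q' < q\<close>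
    by (simp_all add: less_max_iff_disj)
  obtain N where N: "\<And>p. 1 < p \<Longrightarrow> alpha p \<sqsubset> alpha q \<Longrightarrow> (\<And>i. i < N \<Longrightarrow> alpha p i = alpha q i) \<Longrightarrow> q'' < p \<and> p < q"
    using between_of_prefix[OF q''(1,2)] by blast
  obtain m where m: "m > N" "good_prefix (alpha q 0) (alpha q) m" using ex_good_prefix[OF strict]
    by blast
  obtain c where c: "c \<in> self_bounded (alpha q 0)" "c \<sqsubset> alpha q" "\<And>i. i < m \<Longrightarrow> c i = alpha q i"
    using self_bounded_antiperiodic_below[OF strict m(2)] m(1) by auto
  obtain p where p: "p \<in> V" "alpha p = c"
    using self_bounded_imp_alpha[OF c(1)] top_digit_alpha(1)[OF q1] by blast
  have "q'' < p \<and> p < q" using N[of p] V_gt_1[OF p(1)] c m(1) unfolding p(2) by simp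
  then show ?thesis using p(1) q''(3) by (intro bexI[of _ p]) auto
qed

lemma U_left_limit:
  assumes q: "q \<in> V" and strict: "strictly_self_bounded (alpha q 0) (alpha q)" and "q \<notin> U" and "q' < q"
  shows "\<exists>p\<in>U. q' < p \<and> p < q"
proof -
  note q1 = V_gt_1[OF q]
  define q'' where "q'' = max q' ((1 + q) / 2)"
  have q'': "1 < q''" "q'' < q" "q' \<le> q''" unfolding q''_def using q1 \<open>q' < q\<close>
    by (simp_all add: less_max_iff_disj)
  obtain N where N: "\<And>p. 1 < p \<Longrightarrow> alpha p \<sqsubset> alpha q \<Longrightarrow> (\<And>i. i < N \<Longrightarrow> alpha p i = alpha q i) \<Longrightarrow> q'' < p \<and> p < q"
    using between_of_prefix[OF q''(1,2)] by blast
  obtain n where "shift (Suc n) (alpha q) = alpha q"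
    using U_iff[OF q1] \<open>q \<notin> U\<close> strict unfolding strictly_self_bounded_def by blast
  then obtain a where a: "strictly_self_bounded (alpha q 0) a" "\<And>k. k \<ge> 1 \<Longrightarrow> shift k a \<sqsubset> a"
      "a \<sqsubset> alpha q" "\<And>i. i < N \<Longrightarrow> a i = alpha q i"
    using strictly_self_bounded_aperiodic_below[OF strict, of "Suc n" N] by auto
  have aW: "a \<in> self_bounded (alpha q 0)" using a(1) unfolding strictly_self_bounded_def by blast
  obtain p where p: "p \<in> V" "alpha p = a"
    using self_bounded_imp_alpha[OF aW] top_digit_alpha(1)[OF q1] by blast
  note p1 = V_gt_1[OF p(1)]
  have "shift (Suc n) a \<noteq> a" for n using a(2)[of "Suc n"] less_fun_irrefl
    by (metis le_add1 plus_1_eq_Suc)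
  then have "p \<in> U"
    unfolding U_iff[OF p1] p(2) using a(1) self_boundedD(2)[OF aW] unfolding strictly_self_bounded_def
      by simp
  moreover have "q'' < p \<and> p < q" using N[of p] p1 a unfolding p(2) by simp
  ultimately show ?thesis using q''(3) by (intro bexI[of _ p]) auto
qed

lemma closure_U_iff: "q \<in> closure U \<longleftrightarrow> q \<in> V \<and> strictly_self_bounded (alpha q 0) (alpha q)"
proof
  assume q: "q \<in> closure U"
  then have qV: "q \<in> V" using closure_U_subset_V by blast
  have "strictly_self_bounded (alpha q 0) (alpha q)"
  proof (rule ccontr)
    assume n: "\<not> strictly_self_bounded (alpha q 0) (alpha q)"
    obtain l where l: "l < q" "{l<..<q} \<inter> V = {}" using V_left_isolated[OF qV n] by blast
    obtain r where r: "q < r" "{q<..<r} \<inter> V = {}" using V_right_isolated[OF qV n] by blast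
    have "q \<notin> U" using U_imp_strictly_self_bounded n by blast
    have "{l<..<r} \<inter> U = {}"
    proof (rule ccontr)
      assume "{l<..<r} \<inter> U \<noteq> {}"
      then obtain p where p: "p \<in> U" "l < p" "p < r" by auto
      then have "p \<in> V" "p \<noteq> q" using U_subset_V \<open>q \<notin> U\<close> by auto
      then have "p \<in> {l<..<q} \<inter> V \<or> p \<in> {q<..<r} \<inter> V" using p by auto
      then show False using l r by blast
    qed
    then have "{l<..<r} \<inter> closure U = {}" using open_Int_closure_eq_empty[of "{l<..<r}" U] by simp
    then show False using q l r by auto
  qed
  then show "q \<in> V \<and> strictly_self_bounded (alpha q 0) (alpha q)" using qV by blast
next
  assume q: "q \<in> V \<and> strictly_self_bounded (alpha q 0) (alpha q)"
  show "q \<in> closure U"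
  proof (cases "q \<in> U")
    case True
    then show ?thesis using closure_subset by blast
  next
    case False
    show ?thesis unfolding closure_approachable
    proof (intro allI impI)
      fix e :: real assume "0 < e"
      then obtain p where "p \<in> U" "q - e < p" "p < q" using U_left_limit[of q "q - e"] q False
        by auto
      then show "\<exists>y\<in>U. dist y q < e" by (intro bexI[of _ p]) (auto simp: dist_real_def)
    qed
  qed
qed

section \<open>Univoque sequences along a gap\<close>

lemma ball_tails_iff:
  "(\<forall>s\<in>tails A c. P s) \<longleftrightarrow> (\<forall>n. c n < A \<longrightarrow> P (shift (Suc n) c)) \<and>
    (\<forall>n. 0 < c n \<longrightarrow> P (compl_seq A (shift (Suc n) c)))"
proof -
  have "(\<forall>s\<in>{f n | n. Q n}. P s) \<longleftrightarrow> (\<forall>n. Q n \<longrightarrow> P (f n))" for f :: "nat \<Rightarrow> nat \<Rightarrow> nat" and Q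
    by auto
  then show ?thesis unfolding tails_def ball_Un by simp
qed

lemma U_seqs_tails:
  assumes "q > 1"
  shows "c \<in> U_seqs q \<longleftrightarrow> digits_le (alpha q 0) c \<and> (\<forall>s\<in>tails (alpha q 0) c. s \<sqsubset> alpha q)"
  unfolding U_seqs_iff[OF assms] ball_tails_iff ..

lemma V_seqs_tails:
  assumes "q > 1"
  shows "c \<in> V_seqs q \<longleftrightarrow> digits_le (alpha q 0) c \<and> (infinite_seq c \<or> c = (\<lambda>_. 0)) \<and>
    (\<forall>s\<in>tails (alpha q 0) c. s \<sqsubseteq> alpha q)"
  unfolding V_seqs_iff[OF assms] ball_tails_iff ..

lemma U_seqs_mono:
  assumes "1 < p" "p \<le> q" "alpha p 0 = alpha q 0"
  shows "U_seqs p \<subseteq> U_seqs q"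
proof -
  have "alpha p \<sqsubseteq> alpha q" using alpha_le_iff assms by simp
  then show ?thesis using U_seqs_tails[of p] U_seqs_tails[of q] assms lex.less_le_trans
    by (metis (no_types, lifting) less_le_trans subsetI)
qed

text \<open>
  Points of \<open>V\<close> separate. If the alphabets differ, the constant sequence of the larger top digit
  distinguishes the two sets; otherwise a digit 0 followed by \<open>alpha p\<close> does.
\<close>

lemma U_seqs_separated:
  assumes p: "p \<in> V" and "1 < q" "q \<le> p" "p < s"
  shows "U_seqs q \<noteq> U_seqs s"
proof (cases "alpha q 0 = alpha s 0")
  case False
  have s: "1 < s" using assms by simp
  have "alpha q 0 < alpha s 0"
    using False lex_le_first[of "alpha q" "alpha s"] alpha_le_iff[OF \<open>1 < q\<close> s] assms
      by simp
  let ?c = "\<lambda>_. alpha s 0"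
  have sh: "shift k ?c = ?c" for k by (simp add: shift_def)
  have "compl_seq (alpha s 0) ?c \<sqsubset> alpha s"
    unfolding less_fun_def using top_digit_alpha(1)[OF s] by (intro exI[of _ 0]) simp
  then have "?c \<in> U_seqs s" unfolding U_seqs_iff[OF s] sh by (simp add: digits_le_def)
  moreover have "?c \<notin> U_seqs q" unfolding U_seqs_iff[OF \<open>1 < q\<close>] digits_le_def
    using \<open>alpha q 0 < alpha s 0\<close> by auto
  ultimately show ?thesis by blast
next
  case True
  have s: "1 < s" and p1: "1 < p" using assms by simp_all
  have A: "alpha p 0 = alpha s 0"
    using True lex_le_first[of "alpha q" "alpha p"] lex_le_first[of "alpha p" "alpha s"]
      alpha_le_iff[OF \<open>1 < q\<close> p1] alpha_le_iff[OF p1 s] assms by simp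
  define c where "c i = (case i of 0 \<Rightarrow> 0 | Suc j \<Rightarrow> alpha p j)" for i
  have sh: "shift (Suc n) c = shift n (alpha p)" for n by (rule ext) (simp add: c_def)
  have ps: "alpha p \<sqsubset> alpha s" using alpha_strict_mono[OF p1 \<open>p < s\<close>] .
  have "digits_le (alpha s 0) c"
    using digits_leD[OF alpha_props(1)[OF p1]] A unfolding digits_le_def c_def by (simp split: nat.split)
  moreover have "shift (Suc n) c \<sqsubset> alpha s" for n
    unfolding sh using shift_alpha_le[OF p1] ps lex.le_less_trans by blast
  moreover have "compl_seq (alpha s 0) (shift (Suc n) c) \<sqsubset> alpha s" for n
    unfolding sh A[symmetric]
      using self_bounded_compl_le[OF alpha_in_self_bounded[OF p] top_digit_alpha(1)[OF p1]] ps lex.le_less_trans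
      by blast
  ultimately have "c \<in> U_seqs s" unfolding U_seqs_iff[OF s] by blast
  moreover have "c \<notin> U_seqs q"
  proof
    assume "c \<in> U_seqs q"
    moreover have "c 0 < alpha q 0" using top_digit_alpha(1)[OF \<open>1 < q\<close>]
      by (simp add: c_def)
    ultimately have "shift (Suc 0) c \<sqsubset> alpha q" unfolding U_seqs_iff[OF \<open>1 < q\<close>]
      by blast
    then have "alpha p \<sqsubset> alpha q" unfolding sh by simp
    then show False using alpha_less_iff[OF p1 \<open>1 < q\<close>] \<open>q \<le> p\<close> by simp
  qed
  ultimately show ?thesis by blast
qed

text \<open>
  The supremum of the tails of \<open>c\<close> is \<open>alpha r\<close> for some \<open>r \<in> V\<close>, provided that some tail is at
  least \<open>alpha q\<close> for a base \<open>q\<close> with the same top digit (which makes its first digit maximal).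
\<close>

lemma sup_tails_alpha:
  assumes c: "digits_le A c" and q: "1 < q" "alpha q 0 = A"
    and p: "1 < p" "alpha p 0 = A" and bound: "\<And>s. s \<in> tails A c \<Longrightarrow> s \<sqsubseteq> alpha p"
    and s0: "s0 \<in> tails A c" "alpha q \<sqsubseteq> s0"
  obtains r where "r \<in> V" "q \<le> r" "r \<le> p" "alpha r 0 = A"
    "\<And>s. s \<in> tails A c \<Longrightarrow> s \<sqsubseteq> alpha r" "\<And>m. \<exists>s\<in>tails A c. \<forall>i<m. s i = alpha r i"
proof -
  have A1: "1 \<le> A" using top_digit_alpha(1)[OF q(1)] q(2) by simp
  obtain t where t: "\<And>s. s \<in> tails A c \<Longrightarrow> s \<sqsubseteq> t" "\<And>m. \<exists>s\<in>tails A c. \<forall>i<m. s i = t i" "digits_le A t"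
    using lex_sup[of "tails A c" A] s0(1) digits_le_tails[OF c] by blast
  have qt: "alpha q \<sqsubseteq> t" using s0 t(1) lex.order_trans by blast
  then have t0: "t 0 = A" using lex_le_first[OF qt] q(2) digits_leD[OF t(3), of 0] by simp
  have tW: "t \<in> self_bounded A" by (rule sup_tails_in_self_bounded[OF c A1 t(3) t0 t(1,2)])
  then obtain r where r: "r \<in> V" "alpha r = t" using self_bounded_imp_alpha A1 by blast
  note r1 = V_gt_1[OF r(1)]
  have "t \<sqsubseteq> alpha p"
  proof (rule lex_le_limit)
    fix m
    obtain s where "s \<in> tails A c" "\<forall>i<m. s i = t i" using t(2) by blast
    then show "\<exists>c' d'. (\<forall>i<m. c' i = t i) \<and> (\<forall>i<m. d' i = alpha p i) \<and> c' \<sqsubseteq> d'"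
      using bound by blast
  qed
  then have "q \<le> r" "r \<le> p" using qt alpha_le_iff r1 q(1) p(1) r(2) by auto
  then show thesis using that[of r] r t t0 by simp
qed

lemma same_digit_in_gap:
  assumes "{q1<..<q2} \<inter> V = {}" "1 \<le> q1" "q1 < q" "q \<le> q2"
  shows "alpha q 0 = alpha q2 0"
proof -
  have q: "1 < q" and q2: "1 < q2" using assms by auto
  have "real (alpha q2 0) < q"
  proof (rule ccontr)
    assume n: "\<not> ?thesis"
    then have "real (alpha q2 0) \<in> {q1<..<q2}" using top_digit_alpha(2)[OF q2] assms by simp
    then show False using alpha_0_in_V_or_one[OF q2] assms by auto
  qed
  moreover have "q \<le> real (alpha q2 0) + 1" using top_digit_alpha(3)[OF q2] assms by simp
  ultimately show ?thesis using alpha_0_eq_iff[OF q] by blast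
qed

lemma U_seqs_const_on_gap:
  assumes gap: "V_gap q1 q2" and "q1 < q" "q \<le> q2"
  shows "U_seqs q = U_seqs q2"
proof
  have g: "{q1<..<q2} \<inter> V = {}" "q2 \<in> V" "q1 < q2" and "1 \<le> q1"
    using gap V_gap_left_ge_1 unfolding V_gap_def by auto
  have q: "1 < q" using \<open>1 \<le> q1\<close> assms by simp
  note q2 = V_gt_1[OF g(2)]
  define A where "A = alpha q2 0"
  have A: "alpha q 0 = A" "alpha q2 0 = A"
    using same_digit_in_gap[OF g(1) \<open>1 \<le> q1\<close> assms(2,3)] unfolding A_def by simp_all
  show "U_seqs q \<subseteq> U_seqs q2" using U_seqs_mono q assms A by simp
  show "U_seqs q2 \<subseteq> U_seqs q"
  proof (rule subsetI, rule ccontr)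
    fix c assume c: "c \<in> U_seqs q2" "c \<notin> U_seqs q"
    then have dig: "digits_le A c" and less: "\<And>s. s \<in> tails A c \<Longrightarrow> s \<sqsubset> alpha q2"
      unfolding U_seqs_tails[OF q2] A by blast+
    obtain s0 where s0: "s0 \<in> tails A c" "alpha q \<sqsubseteq> s0"
      using c(2) dig unfolding U_seqs_tails[OF q] A by (meson lex.not_less)
    obtain r where r: "r \<in> V" "q \<le> r" "r \<le> q2" "\<And>m. \<exists>s\<in>tails A c. \<forall>i<m. s i = alpha r i"
      using sup_tails_alpha[OF dig q A(1) q2 A(2) _ s0] less unfolding lex_le_def by metis
    have "r = q2"
    proof (rule ccontr)
      assume "r \<noteq> q2"
      then have "r \<in> {q1<..<q2} \<inter> V" using r assms by simp
      then show False using g by blast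
    qed
    \<comment> \<open>\<open>q2\<close> is isolated from the left, so \<open>alpha q2\<close> is the complement of one of its tails; then \<open>s\<close> close to \<open>alpha q2\<close> exceeds it\<close>
    have "\<not> strictly_self_bounded A (alpha q2)"
      using V_left_limit[OF g(2) _ g(3)] g(1) unfolding A(2)
      by (metis disjoint_iff greaterThanLessThan_iff)
    then obtain k where k: "k \<ge> 1" "compl_seq A (shift k (alpha q2)) = alpha q2"
      using strictly_self_bounded_alpha_iff[OF g(2)] unfolding A(2) by blast
    obtain s where s: "s \<in> tails A c" "\<forall>i<k. s i = alpha q2 i"
      using r(4) \<open>r = q2\<close> by blast
    have "0 < s 0" using s(2) k(1) A(2) top_digit_alpha(1)[OF q2] by simp
    then obtain s' where s': "s' \<in> tails A c" "compl_seq A (shift k s) \<sqsubseteq> s'"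
      using tails_dominate(2)[OF dig s(1) _ k(1)] by blast
    have "compl_seq A (shift k s) \<sqsubset> compl_seq A (shift k (alpha q2))"
      unfolding k(2) using s' less lex.le_less_trans by blast
    then have "shift k (alpha q2) \<sqsubset> shift k s"
      using compl_less_iff[of A "shift k s" "shift k (alpha q2)"] digits_le_tails[OF dig s(1)]
        alpha_props(1)[OF q2] A(2) by simp
    then have "alpha q2 \<sqsubset> s" using s(2) by (subst (asm) shift_less_iff) auto
    then show False using less[OF s(1)] less_fun_asym by blast
  qed
qed

lemma U_seqs_infinite_or_zero:
  assumes q: "1 < q" and c: "c \<in> U_seqs q"
  shows "infinite_seq c \<or> c = (\<lambda>_. 0)"
proof (rule ccontr)
  assume n: "\<not> ?thesis"
  then obtain m where m: "\<And>l. m \<le> l \<Longrightarrow> shift l c = (\<lambda>_. 0)"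
    using not_infinite_seqE by blast
  have tail0: "c i = 0" if "m \<le> i" for i using fun_cong[OF m[OF that], of 0] by simp
  obtain i where "0 < c i" using n by auto
  define n where "n = (GREATEST i. 0 < c i)"
  have bd: "\<forall>y. 0 < c y \<longrightarrow> y \<le> m" using tail0
    by (metis less_irrefl nat_le_linear)
  have n: "0 < c n" "\<And>y. 0 < c y \<Longrightarrow> y \<le> n"
    unfolding n_def
      using GreatestI_nat[of "\<lambda>i. 0 < c i", OF \<open>0 < c i\<close>] Greatest_le_nat[of "\<lambda>i. 0 < c i"] bd
      by blast+
  have "shift (Suc n) c = (\<lambda>_. 0)"
    by (rule ext) (use n(2) in \<open>force simp: not_less_eq_eq[symmetric]\<close>)
  moreover have "compl_seq (alpha q 0) (shift (Suc n) c) \<sqsubset> alpha q"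
    using c n(1) unfolding U_seqs_iff[OF q] by blast
  ultimately have less: "(\<lambda>_. alpha q 0) \<sqsubset> alpha q" by (simp add: compl_seq_def)
  then have "alpha q = (\<lambda>_. alpha q 0)"
    using const_le_imp_eq[OF alpha_props(1)[OF q]] unfolding lex_le_def by blast
  then show False using less less_fun_irrefl by metis
qed

text \<open>
  Here \<open>q1\<close> is not an integer, since the integers \<open>\<ge> 2\<close> are in \<open>U\<close>; so the alphabet is the same
  for \<open>q1\<close> and on the gap. A tail exceeding \<open>alpha q1\<close> would produce an element of \<open>V\<close> in the gap.
\<close>

lemma U_seqs_gap_eq_V_seqs:
  assumes gap: "V_gap q1 q2" and q1: "q1 \<in> V - U" and q: "q1 < q" "q \<le> q2"
  shows "U_seqs q = V_seqs q1"
proof -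
  have g: "{q1<..<q2} \<inter> V = {}" "q2 \<in> V" "q1 < q2" and "1 \<le> q1"
    using gap V_gap_left_ge_1 unfolding V_gap_def by auto
  have q1': "1 < q1" using q1 V_gt_1 by blast
  define A where "A = alpha q1 0"
  have A1: "1 \<le> A" using top_digit_alpha(1)[OF q1'] unfolding A_def .
  have "q1 \<noteq> real A + 1" using q1 integer_in_U(1)[OF A1] by blast
  then have "q1 < real A + 1" using top_digit_alpha(3)[OF q1'] unfolding A_def by simp
  then have "q2 \<le> real A + 1"
    using integer_in_V[OF A1] g(1) by (metis disjoint_iff greaterThanLessThan_iff not_le)
  then have A: "alpha p 0 = A" if "q1 < p" "p \<le> q2" for p
    using alpha_0_eq_iff[of p A] that q1' top_digit_alpha(2)[OF q1'] unfolding A_def by simp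
  have qgt: "1 < q" using q q1' by simp
  show ?thesis
  proof
    show "V_seqs q1 \<subseteq> U_seqs q"
    proof
      fix c assume "c \<in> V_seqs q1"
      then show "c \<in> U_seqs q"
        unfolding V_seqs_tails[OF q1'] U_seqs_tails[OF qgt] A[OF q] A_def[symmetric]
        using alpha_strict_mono[OF q1' q(1)] lex.le_less_trans by blast
    qed
    show "U_seqs q \<subseteq> V_seqs q1"
    proof
      fix c assume c: "c \<in> U_seqs q"
      define p where "p = (q1 + q2) / 2"
      have p: "q1 < p" "p < q2" using g(3) unfolding p_def by simp_all
      have "c \<in> U_seqs p" using U_seqs_const_on_gap[OF gap q] U_seqs_const_on_gap[OF gap p(1)] p(2) c
        by simp
      then have dig: "digits_le A c" and less: "\<And>s. s \<in> tails A c \<Longrightarrow> s \<sqsubset> alpha p"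
        using U_seqs_tails[of p] A[of p] p q1' by auto
      have "s \<sqsubseteq> alpha q1" if s: "s \<in> tails A c" for s
      proof (rule ccontr)
        assume n: "\<not> s \<sqsubseteq> alpha q1"
        then have le: "alpha q1 \<sqsubseteq> s" using lex.linear by blast
        obtain r where r: "r \<in> V" "q1 \<le> r" "r \<le> p" "\<And>s. s \<in> tails A c \<Longrightarrow> s \<sqsubseteq> alpha r"
          using sup_tails_alpha[OF dig q1' A_def[symmetric] _ A[of p] _ s le] p q1' less
          unfolding lex_le_def by (metis less_imp_le order.strict_trans)
        have "r \<noteq> q1" using r(4)[OF s] n by blast
        then have "r \<in> {q1<..<q2} \<inter> V" using r p by simp
        then show False using g by blast
      qed
      then show "c \<in> V_seqs q1" unfolding V_seqs_tails[OF q1'] A_def[symmetric]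
        using dig U_seqs_infinite_or_zero[OF qgt c] by blast
    qed
  qed
qed

section \<open>Maximal stability intervals\<close>

lemma V_gap_iff_component: "{q1<..<q2} \<in> components ({1<..} - V) \<longleftrightarrow> V_gap q1 q2"
proof
  assume comp: "{q1<..<q2} \<in> components ({1<..} - V)"
  then have ne: "{q1<..<q2} \<noteq> {}" and sub: "{q1<..<q2} \<subseteq> {1<..} - V"
    using in_components_nonempty in_components_subset by blast+
  define x where "x = (q1 + q2) / 2"
  have x: "x \<in> {q1<..<q2}" using ne unfolding x_def by auto
  then obtain a b where g: "V_gap a b" "a < x" "x < b" using ex_V_gap[of x] sub by blast
  have "{a<..<b} \<subseteq> {1<..} - V"
    using g(1) V_gap_left_ge_1[OF g(1)] unfolding V_gap_def by force
  then have sub2: "{a<..<b} \<subseteq> {q1<..<q2}"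
    using x g(2,3) by (intro components_maximal[OF comp connected_Ioo]) auto
  have "q1 \<le> a" "b \<le> q2"
    using sub2 g greaterThanLessThan_subseteq_greaterThanLessThan[of a b q1 q2] by auto
  moreover have "a \<notin> {q1<..<q2}" "b \<notin> {q1<..<q2}" using sub g(1) unfolding V_gap_def
    by auto
  ultimately have "q1 = a" "q2 = b" using x g by auto
  then show "V_gap q1 q2" using g by simp
next
  assume g: "V_gap q1 q2"
  have 1: "1 \<le> q1" using V_gap_left_ge_1[OF g] .
  have out: "q1 \<notin> {1<..} - V" "q2 \<notin> {1<..} - V" using g unfolding V_gap_def by auto
  have "d = {q1<..<q2}" if d: "{q1<..<q2} \<subseteq> d" "d \<subseteq> {1<..} - V" "connected d" for d
  proof -
    define x where "x = (q1 + q2) / 2"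
    have x: "q1 < x" "x < q2" using g unfolding x_def V_gap_def by auto
    then have xd: "x \<in> d" using d(1) by auto
    have "q1 < y \<and> y < q2" if "y \<in> d" for y
      using connectedD_interval[OF d(3) that xd, of q1] connectedD_interval[OF d(3) xd that, of q2] out d(2) x
      by (meson less_imp_le not_le subsetD)
    then show ?thesis using d(1) by auto
  qed
  then show "{q1<..<q2} \<in> components ({1<..} - V)"
    unfolding in_components_maximal using g 1 unfolding V_gap_def by auto
qed

lemma V_gap_unique:
  assumes "V_gap q1 q2" "V_gap p1 p2" "{q1<..q2} \<subseteq> {p1<..p2}"
  shows "q1 = p1" "q2 = p2"
proof -
  have "q1 < q2" "p1 < p2" using assms unfolding V_gap_def by auto
  have "p1 \<le> q1"
  proof (rule ccontr)
    assume "\<not> p1 \<le> q1"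
    then have "min p1 q2 \<in> {p1<..p2}" using assms(3) \<open>q1 < q2\<close>
      by (intro subsetD[OF assms(3)]) auto
    then show False by simp
  qed
  moreover have "q2 \<le> p2" using subsetD[OF assms(3), of q2] \<open>q1 < q2\<close> by simp
  ultimately have le: "p1 \<le> q1" "q2 \<le> p2" .
  have "q1 \<notin> {p1<..<p2}" "q2 \<notin> {p1<..<p2}"
    using assms(1,2) V_gap_left_ge_1[OF assms(2)] unfolding V_gap_def by auto
  then show "q1 = p1" "q2 = p2" using le \<open>q1 < q2\<close> by auto
qed

lemma stability_interval_of_gap:
  assumes "V_gap q1 q2"
  shows "stability_interval {q1<..q2}"
proof -
  have "U_seqs q = U_seqs s" if "q \<in> {q1<..q2}" "s \<in> {q1<..q2}" for q s
    using U_seqs_const_on_gap[OF assms, of q] U_seqs_const_on_gap[OF assms, of s] that by simp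
  moreover have "{q1<..q2} \<noteq> {}" "{q1<..q2} \<subseteq> {1<..}"
    using assms V_gap_left_ge_1[OF assms] unfolding V_gap_def by auto
  ultimately show ?thesis unfolding stability_interval_def using is_interval_oc by blast
qed

lemma stability_intervalD:
  assumes "stability_interval I"
  shows "I \<noteq> {}" "x \<in> I \<Longrightarrow> 1 < x" "x \<in> I \<Longrightarrow> y \<in> I \<Longrightarrow> x \<le> z \<Longrightarrow> z \<le> y \<Longrightarrow> z \<in> I"
    "x \<in> I \<Longrightarrow> y \<in> I \<Longrightarrow> U_seqs x = U_seqs y"
proof -
  have I: "I \<noteq> {}" "I \<subseteq> {1<..}" "\<forall>a\<in>I. \<forall>b\<in>I. \<forall>x. a \<le> x \<longrightarrow> x \<le> b \<longrightarrow> x \<in> I"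
      "\<forall>q\<in>I. \<forall>s\<in>I. U_seqs q = U_seqs s"
    using assms unfolding stability_interval_def is_interval_1 by meson+
  show "I \<noteq> {}" by (rule I(1))
  show "1 < x" if "x \<in> I" using I(2) that by blast
  show "z \<in> I" if "x \<in> I" "y \<in> I" "x \<le> z" "z \<le> y" using I(3) that by blast
  show "U_seqs x = U_seqs y" if "x \<in> I" "y \<in> I" by (rule I(4)[rule_format, OF that])
qed

lemma stability_interval_in_gap:
  assumes I: "stability_interval I" and "x \<in> I" "y \<in> I" "x < y"
  obtains q1 q2 where "V_gap q1 q2" "I \<subseteq> {q1<..q2}"
proof -
  have sep: "p \<notin> V" if "a \<in> I" "b \<in> I" "a \<le> p" "p < b" for a b p
    using U_seqs_separated[of p a b] that stability_intervalD(2)[OF I that(1)] stability_intervalD(4)[OF I that(1,2)]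
    by blast
  define z where "z = (x + y) / 2"
  have z: "x < z" "z < y" using \<open>x < y\<close> unfolding z_def by auto
  have zI: "z \<in> I" using stability_intervalD(3)[OF I, of x y z] assms z by simp
  have "1 < z" by (rule stability_intervalD(2)[OF I zI])
  moreover have "z \<notin> V" using sep[of x y z] assms z by simp
  ultimately obtain q1 q2 where g: "V_gap q1 q2" "q1 < z" "z < q2" using ex_V_gap by blast
  have "w \<in> {q1<..q2}" if "w \<in> I" for w
  proof -
    have "1 < w" by (rule stability_intervalD(2)[OF I that])
    then have "\<not> w \<le> q1" using sep[OF that zI, of q1] g unfolding V_gap_def by auto
    moreover have "\<not> q2 < w" using sep[OF zI that, of q2] g unfolding V_gap_def by auto
    ultimately show ?thesis by simp
  qed
  then show thesis using that g(1) by blast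
qed

lemma closure_U_not_in_gap:
  assumes "q \<in> closure U" "V_gap q1 q2"
  shows "q \<notin> {q1<..q2}"
proof
  assume q: "q \<in> {q1<..q2}"
  have qV: "q \<in> V" and strict: "strictly_self_bounded (alpha q 0) (alpha q)"
    using assms(1) closure_U_iff by blast+
  then have "q = q2" using q assms(2) unfolding V_gap_def
    by (metis disjoint_iff greaterThanAtMost_iff greaterThanLessThan_iff order_le_less)
  then show False using V_left_limit[OF qV strict, of q1] assms(2) unfolding V_gap_def
    by (metis disjoint_iff greaterThanLessThan_iff)
qed

lemma in_closure_U_or_gap:
  assumes "1 < q"
  shows "q \<in> closure U \<or> (\<exists>q1 q2. V_gap q1 q2 \<and> q \<in> {q1<..q2})"
proof (cases "q \<in> V")
  case True
  show ?thesis
  proof (cases "q \<in> closure U")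
    case False
    then have "\<not> strictly_self_bounded (alpha q 0) (alpha q)" using closure_U_iff True by blast
    then obtain q1 where "q1 < q" "q1 \<in> V \<or> q1 = 1" "{q1<..<q} \<inter> V = {}"
      using V_left_isolated True by blast
    then have "V_gap q1 q" unfolding V_gap_def using True by blast
    then show ?thesis using \<open>q1 < q\<close> by auto
  qed simp
next
  case False
  then obtain q1 q2 where "V_gap q1 q2" "q1 < q" "q < q2" using ex_V_gap assms by blast
  then show ?thesis by (intro disjI2 exI[of _ q1] exI[of _ q2]) auto
qed

lemma maximal_stability_interval_iff:
  "maximal_stability_interval I \<longleftrightarrow>
    (\<exists>q\<in>closure U. I = {q}) \<or> (\<exists>q1 q2. V_gap q1 q2 \<and> I = {q1<..q2})"
proof
  assume max: "maximal_stability_interval I"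
  then have I: "stability_interval I" unfolding maximal_stability_interval_def by blast
  have gap: ?thesis if "V_gap q1 q2" "I \<subseteq> {q1<..q2}" for q1 q2
    using max stability_interval_of_gap[OF that(1)] that unfolding maximal_stability_interval_def
      by metis
  obtain x where x: "x \<in> I" "1 < x" using stability_intervalD[OF I] by blast
  show "(\<exists>q\<in>closure U. I = {q}) \<or> (\<exists>q1 q2. V_gap q1 q2 \<and> I = {q1<..q2})"
  proof (cases "I = {x}")
    case True
    then show ?thesis using in_closure_U_or_gap[OF x(2)] gap max by blast
  next
    case False
    then obtain y where "y \<in> I" "y \<noteq> x" using x(1) by blast
    then obtain u v where "u \<in> I" "v \<in> I" "u < v" using x(1)
      by (meson linorder_neqE_linordered_idom)
    then show ?thesis using stability_interval_in_gap[OF I] gap max by metis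
  qed
next
  assume "(\<exists>q\<in>closure U. I = {q}) \<or> (\<exists>q1 q2. V_gap q1 q2 \<and> I = {q1<..q2})"
  then consider q where "q \<in> closure U" "I = {q}" | q1 q2 where "V_gap q1 q2" "I = {q1<..q2}"
    by blast
  then show "maximal_stability_interval I"
  proof cases
    case 1
    have "1 < q" using 1(1) closure_U_subset_V V_gt_1 by blast
    then have "stability_interval {q}" unfolding stability_interval_def by (simp add: is_interval_1)
    moreover have "I' = {q}" if I': "stability_interval I'" "{q} \<subseteq> I'" for I'
    proof (rule ccontr)
      assume "I' \<noteq> {q}"
      then obtain y where "y \<in> I'" "y \<noteq> q" using I'(2) by blast
      then obtain u v where "u \<in> I'" "v \<in> I'" "u < v" using I'(2)
        by (meson insert_subset linorder_neqE_linordered_idom)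
      then obtain q1 q2 where "V_gap q1 q2" "I' \<subseteq> {q1<..q2}"
        using stability_interval_in_gap[OF I'(1)] by blast
      then show False using closure_U_not_in_gap[OF 1(1)] I'(2) by blast
    qed
    ultimately show ?thesis unfolding maximal_stability_interval_def 1(2) by blast
  next
    case 2
    have "I' = {q1<..q2}" if I': "stability_interval I'" "{q1<..q2} \<subseteq> I'" for I'
    proof -
      define x where "x = (q1 + q2) / 2"
      have "q1 < x" "x < q2" using 2(1) unfolding V_gap_def x_def by auto
      then have "x \<in> I'" "q2 \<in> I'" "x < q2" using I'(2) by auto
      then obtain p1 p2 where p: "V_gap p1 p2" "I' \<subseteq> {p1<..p2}"
        using stability_interval_in_gap[OF I'(1)] by blast
      then have "q1 = p1" "q2 = p2" using V_gap_unique[OF 2(1)] I'(2) by blast+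
      then show ?thesis using p I'(2) by blast
    qed
    then show ?thesis unfolding maximal_stability_interval_def 2(2)
      using stability_interval_of_gap[OF 2(1)] by blast
  qed
qed

theorem theorem1p7:
  shows "({I. maximal_stability_interval I} =
           {{q} | q. q \<in> closure U} \<union>
           {{q1<..q2} | q1 q2. {q1<..<q2} \<in> components ({1<..} - V)}) \<and>
         (\<forall>q1 q2. {q1<..<q2} \<in> components ({1<..} - V) \<and> q1 \<in> V - U \<longrightarrow>
           (\<forall>q\<in>{q1<..q2}. U_seqs q = V_seqs q1))"
proof (intro conjI allI impI ballI)
  show "{I. maximal_stability_interval I} = {{q} | q. q \<in> closure U} \<union>
      {{q1<..q2} | q1 q2. {q1<..<q2} \<in> components ({1<..} - V)}"
    unfolding V_gap_iff_component maximal_stability_interval_iff by blast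
next
  fix q1 q2 q
  assume *: "{q1<..<q2} \<in> components ({1<..} - V) \<and> q1 \<in> V - U" "q \<in> {q1<..q2}"
  show "U_seqs q = V_seqs q1"
  proof (rule U_seqs_gap_eq_V_seqs)
    show "V_gap q1 q2" using *(1) V_gap_iff_component by blast
  qed (use * in auto)
qed

end
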